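(* Assume that $\mathfrak b=\mathfrak d$. Then: (1) For every $\le^*$-unbounded set $X\subseteq[\mathbb N]^\infty$, there is a $\mathfrak d$-concentrated real set $Y$ such that the product space $X\times Y$ is not Menger. (2) Let $X$ be a real set. If $X\times Y$ is Menger for every hereditarily Lindelöf Menger space $Y$, then $X\times Y$ is Hurewicz for every hereditarily Lindelöf Hurewicz space $Y$. (That is: in the realm of hereditarily Lindelöf spaces, if a real set is productively Menger, then it is productively Hurewicz.)
   Context: The family $P(\mathbb N)$ of all subsets of $\mathbb N$ is identified with the Cantor space $\{0,1\}^{\mathbb N}$, with its topology; $[\mathbb N]^{\infty}$ is the subspace of infinite subsets of $\mathbb N$. Each $a\in[\mathbb N]^\infty$ is identified with its increasing enumeration: $a(n)$ is the $n$-th element of $a$. A real set is a set of real numbers with the subspace topology; subspaces of $P(\mathbb N)$ are regarded as real sets. For $a,b\in[\mathbb N]^\infty$, $a\le^* b$ means $a(n)\le b(n)$ for all but finitely many $n$. A set $X\subseteq[\mathbb N]^\infty$ is $\le^*$-unbounded if there is no $b\in[\mathbb N]^\infty$ with $x\le^* b$ for all $x\in X$. $\mathfrak b$ is the minimal cardinality of a $\le^*$-unbounded subset of $[\mathbb N]^\infty$, and $\mathfrak d$ is the minimal cardinality of a dominating set, i.e. a set $D\subseteq[\mathbb N]^\infty$ such that for each $a\in[\mathbb N]^\infty$ there is $d\in D$ with $a\le^* d$. For an infinite cardinal $\kappa$, a topological space $Y$ with $|Y|\ge\kappa$ is $\kappa$-concentrated if there is a countable set $D\subseteq Y$ such that $|Y\setminus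 U|<\kappa$ for all open sets $U\supseteq D$. A topological space $X$ is Menger (respectively, Hurewicz) if for each sequence $\mathcal U_1,\mathcal U_2,\dots$ of open covers of $X$ there are finite sets $\mathcal F_1\subseteq\mathcal U_1,\mathcal F_2\subseteq\mathcal U_2,\dots$ such that for every $x\in X$ the set $\{n: x\in\bigcup\mathcal F_n\}$ is nonempty, equivalently can be required infinite (respectively, is cofinite in $\mathbb N$). *)

theory Defs
  imports "HOL-Analysis.Analysis"
begin

unbundle cardinal_syntax

section \<open>Subsets of the natural numbers\<close>

text \<open>The topology on the power set of the naturals that makes \<open>A \<mapsto> (\<lambda>n. n \<in> A)\<close> a
  homeomorphism onto the product of countably many copies of the discrete two-point space.\<close>

definition cantor_topology :: "nat set topology" where
  "cantor_topology =
     pullback_topology UNIV (\<lambda>A n. n \<in> A)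
       (product_topology (\<lambda>n::nat. discrete_topology (UNIV :: bool set)) UNIV)"

definition infinite_subsets :: "nat set set" where
  "infinite_subsets = {a. infinite a}"

text \<open>\<open>enumerate a\<close> is the increasing enumeration of \<open>a\<close>, starting at index 0.\<close>

definition le_star :: "nat set \<Rightarrow> nat set \<Rightarrow> bool" (infix "\<le>*" 50) where
  "a \<le>* b \<longleftrightarrow> finite {n. \<not> enumerate a n \<le> enumerate b n}"

definition unbounded_family :: "nat set set \<Rightarrow> bool" where
  "unbounded_family X \<longleftrightarrow>
     X \<subseteq> infinite_subsets \<and> \<not> (\<exists>b\<in>infinite_subsets. \<forall>x\<in>X. x \<le>* b)"

definition dominating_family :: "nat set set \<Rightarrow> bool" where
  "dominating_family D \<longleftrightarrow>
     D \<subseteq> infinite_subsets \<and> (\<forall>a\<in>infinite_subsets. \<exists>d\<in>D. a \<le>* d)"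

section \<open>The cardinals b and d\<close>

text \<open>The minimal cardinality of a set with property \<open>P\<close>, represented, as is every cardinal here,
  by a cardinal order; it is determined up to \<open>=o\<close>, provided that some set satisfies \<open>P\<close>.\<close>

definition min_card :: "('a set \<Rightarrow> bool) \<Rightarrow> 'a rel" where
  "min_card P = |SOME A. P A \<and> (\<forall>B. P B \<longrightarrow> |A| \<le>o |B| )|"

definition frak_b :: "nat set rel" where
  "frak_b = min_card unbounded_family"

definition frak_d :: "nat set rel" where
  "frak_d = min_card dominating_family"

lemma min_card:
  assumes "P A"
  shows "\<exists>B. P B \<and> min_card P = |B|" and "min_card P \<le>o |A|"
proof -
  have "\<exists>r\<in>card_of ` Collect P. \<forall>r'\<in>card_of ` Collect P. r \<le>o r'"
    using assms by (intro exists_minim_Card_order) (auto simp: card_of_Card_order)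
  then have "\<exists>B. P B \<and> (\<forall>C. P C \<longrightarrow> |B| \<le>o |C| )"
    by auto
  then have *: "P (SOME B. P B \<and> (\<forall>C. P C \<longrightarrow> |B| \<le>o |C| )) \<and>
      (\<forall>C. P C \<longrightarrow> |SOME B. P B \<and> (\<forall>C. P C \<longrightarrow> |B| \<le>o |C| )| \<le>o |C| )"
    by (rule someI_ex)
  then show "\<exists>B. P B \<and> min_card P = |B|" and "min_card P \<le>o |A|"
    using assms unfolding min_card_def by blast+
qed

lemma unbounded_family_infinite_subsets: "unbounded_family infinite_subsets"
  unfolding unbounded_family_def
proof (intro conjI notI; (elim bexE)?)
  fix b assume b: "b \<in> infinite_subsets" "\<forall>x\<in>infinite_subsets. x \<le>* b"
  let ?x = "b - {LEAST n. n \<in> b}"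
  have inf: "infinite b"
    using b(1) by (simp add: infinite_subsets_def)
  then have "?x \<le>* b"
    using b(2) by (simp add: infinite_subsets_def)
  moreover have "\<not> enumerate ?x n \<le> enumerate b n" for n
    using enumerate_step[OF inf, of n] by (simp add: enumerate_Suc)
  ultimately show False
    by (simp add: le_star_def)
qed simp

lemma dominating_family_infinite_subsets: "dominating_family infinite_subsets"
  unfolding dominating_family_def le_star_def by (auto intro!: bexI)

lemma frak_b:
  shows "\<exists>X. unbounded_family X \<and> frak_b = |X|"
    and "unbounded_family X \<Longrightarrow> frak_b \<le>o |X|"
  unfolding frak_b_def using min_card[of unbounded_family] unbounded_family_infinite_subsets
  by blast+

lemma frak_d:
  shows "\<exists>D. dominating_family D \<and> frak_d = |D|"
    and "dominating_family D \<Longrightarrow> frak_d \<le>o |D|"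
  unfolding frak_d_def using min_card[of dominating_family] dominating_family_infinite_subsets
  by blast+

section \<open>Concentrated, Menger and Hurewicz spaces\<close>

text \<open>The parameter \<open>\<kappa>\<close> is meant to be an infinite cardinal order.\<close>

definition concentrated :: "'k rel \<Rightarrow> 'a topology \<Rightarrow> bool" where
  "concentrated \<kappa> Y \<longleftrightarrow>
     \<kappa> \<le>o |topspace Y| \<and>
     (\<exists>D. D \<subseteq> topspace Y \<and> countable D \<and>
        (\<forall>U. openin Y U \<and> D \<subseteq> U \<longrightarrow> |topspace Y - U| <o \<kappa>))"

definition open_cover :: "'a topology \<Rightarrow> 'a set set \<Rightarrow> bool" where
  "open_cover X \<U> \<longleftrightarrow> (\<forall>U\<in>\<U>. openin X U) \<and> \<Union>\<U> = topspace X"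

definition Menger_space :: "'a topology \<Rightarrow> bool" where
  "Menger_space X \<longleftrightarrow>
     (\<forall>\<U> :: nat \<Rightarrow> 'a set set. (\<forall>n. open_cover X (\<U> n)) \<longrightarrow>
        (\<exists>\<F>. (\<forall>n. finite (\<F> n) \<and> \<F> n \<subseteq> \<U> n) \<and>
             (\<forall>x\<in>topspace X. {n. x \<in> \<Union>(\<F> n)} \<noteq> {})))"

definition Hurewicz_space :: "'a topology \<Rightarrow> bool" where
  "Hurewicz_space X \<longleftrightarrow>
     (\<forall>\<U> :: nat \<Rightarrow> 'a set set. (\<forall>n. open_cover X (\<U> n)) \<longrightarrow>
        (\<exists>\<F>. (\<forall>n. finite (\<F> n) \<and> \<F> n \<subseteq> \<U> n) \<and>
             (\<forall>x\<in>topspace X. finite (- {n. x \<in> \<Union>(\<F> n)}))))"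

end

theory Submission
  imports Defs
begin

text \<open>
  Let \<open>f\<close> assign nondecreasing functions on the naturals to the points of a space \<open>Z\<close> so that the
  sets \<open>{z. f z n \<le> m}\<close> are open, and suppose that its values are unbounded. If b = d, then for
  each member \<open>d\<close> of a dominating scale there is \<open>z\<close> with \<open>f z > d \<circ> d\<close> infinitely often,
  so \<open>f z\<close> exceeds \<open>d\<close> on a set \<open>J\<close> that contains infinitely many intervals \<open>[n, d n]\<close>. These long
  intervals make the sets \<open>J\<close>, together with the cofinite sets, d-concentrated, and the sets of all
  \<open>(z, J)\<close> with \<open>f z k \<le> m\<close> for some \<open>k \<in> J\<close>, \<open>k \<ge> n\<close>, witness that \<open>Z\<close> times this set is not Menger.
  Part (1) is the case of enumerations.

  For part (2), if \<open>X \<times> Y\<close> is not Hurewicz, then it carries such an unbounded map, which yields a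
  concentrated set \<open>C\<close> with \<open>(X \<times> Y) \<times> C\<close> not Menger. But the product of a Hurewicz space with a
  concentrated set is Menger if b = d, so \<open>X \<times> (Y \<times> C)\<close> contradicts the productivity of \<open>X\<close>.
\<close>

section \<open>Lindelof, Menger and Hurewicz spaces\<close>

text \<open>The Lindelof property is applied to the subspace \<open>\<Union>\<U>\<close>. In this
  form the product arguments below need not mention subspaces.\<close>

lemma hereditarily_Lindelof_iff:
  "hereditarily Lindelof_space X \<longleftrightarrow>
     (\<forall>\<U>. (\<forall>U\<in>\<U>. openin X U) \<longrightarrow> (\<exists>\<V>. countable \<V> \<and> \<V> \<subseteq> \<U> \<and> \<Union>\<V> = \<Union>\<U>))"
    (is "_ \<longleftrightarrow> ?R")
proof
  assume X: "hereditarily Lindelof_space X"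
  show ?R
  proof (intro allI impI)
    fix \<U> assume op: "\<forall>U\<in>\<U>. openin X U"
    then have sub: "\<Union>\<U> \<subseteq> topspace X"
      using openin_subset by blast
    then have "Lindelof_space (subtopology X (\<Union>\<U>))"
      using X by (simp add: hereditarily_def)
    with sub op show "\<exists>\<V>. countable \<V> \<and> \<V> \<subseteq> \<U> \<and> \<Union>\<V> = \<Union>\<U>"
      unfolding Lindelof_space_subtopology_subset[OF sub] by (metis Union_mono antisym order_refl)
  qed
next
  assume R: ?R
  show "hereditarily Lindelof_space X"
    unfolding hereditarily_def
  proof (intro allI impI)
    fix S assume S: "S \<subseteq> topspace X"
    show "Lindelof_space (subtopology X S)"
      unfolding Lindelof_space_subtopology_subset[OF S] using R by metis
  qed
qed

lemma hereditarily_Lindelof_continuous_map_image: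
  assumes X: "hereditarily Lindelof_space X" and f: "continuous_map X Y f"
    and im: "f ` topspace X = topspace Y"
  shows "hereditarily Lindelof_space Y"
  unfolding hereditarily_Lindelof_iff
proof (intro allI impI)
  fix \<U> assume op: "\<forall>U\<in>\<U>. openin Y U"
  define pre where "pre U = {x \<in> topspace X. f x \<in> U}" for U
  have "\<forall>V\<in>pre ` \<U>. openin X V"
    using op f by (auto simp: pre_def intro: openin_continuous_map_preimage)
  then obtain \<W> where "countable \<W>" "\<W> \<subseteq> pre ` \<U>" "\<Union>\<W> = \<Union>(pre ` \<U>)"
    using X unfolding hereditarily_Lindelof_iff by metis
  then obtain \<V> where V: "countable \<V>" "\<V> \<subseteq> \<U>" "\<Union>(pre ` \<V>) = \<Union>(pre ` \<U>)"
    by (metis countable_subset_image)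
  have "\<Union>\<U> \<subseteq> \<Union>\<V>"
  proof
    fix y assume "y \<in> \<Union>\<U>"
    then obtain U where U: "U \<in> \<U>" "y \<in> U" by blast
    then have "y \<in> f ` topspace X" unfolding im using op openin_subset by blast
    then obtain x where "x \<in> topspace X" "f x = y" by blast
    then have "x \<in> \<Union>(pre ` \<V>)" using U unfolding V(3) pre_def by blast
    then show "y \<in> \<Union>\<V>" using \<open>f x = y\<close> by (auto simp: pre_def)
  qed
  then show "\<exists>\<V>. countable \<V> \<and> \<V> \<subseteq> \<U> \<and> \<Union>\<V> = \<Union>\<U>"
    using V(1,2) by (intro exI[of _ \<V>]) auto
qed

text \<open>For each basic open \<open>A\<close> of \<open>X\<close>, consider all open
  \<open>B\<close> with \<open>A \<times> B\<close> inside a member of \<open>\<U>\<close>. By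
  hereditary Lindelofness, countably many of these \<open>B\<close> have the same union, and the
  basis of \<open>X\<close> is countable.\<close>

lemma countable_rectangle_refinement:
  assumes X: "second_countable X" and Y: "hereditarily Lindelof_space Y"
    and op: "\<And>U. U \<in> \<U> \<Longrightarrow> openin (prod_topology X Y) U"
  obtains \<R> where "countable \<R>"
    "\<And>A B. (A, B) \<in> \<R> \<Longrightarrow> openin X A \<and> openin Y B \<and> (\<exists>U\<in>\<U>. A \<times> B \<subseteq> U)"
    "(\<Union>(A, B)\<in>\<R>. A \<times> B) = \<Union>\<U>"
proof -
  obtain \<B> where \<B>: "countable \<B>" "\<And>V. V \<in> \<B> \<Longrightarrow> openin X V"
    "\<And>U x. openin X U \<Longrightarrow> x \<in> U \<Longrightarrow> \<exists>V\<in>\<B>. x \<in> V \<and> V \<subseteq> U"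
    using X unfolding second_countable_def by metis
  define \<C> where "\<C> A = {B. openin Y B \<and> (\<exists>U\<in>\<U>. A \<times> B \<subseteq> U)}" for A
  have "\<forall>A. \<exists>\<D>. countable \<D> \<and> \<D> \<subseteq> \<C> A \<and> \<Union>\<D> = \<Union>(\<C> A)"
    using Y unfolding hereditarily_Lindelof_iff by (simp add: \<C>_def)
  then obtain \<D> where \<D>: "\<And>A. countable (\<D> A)" "\<And>A. \<D> A \<subseteq> \<C> A" "\<And>A. \<Union>(\<D> A) = \<Union>(\<C> A)"
    by metis
  define \<R> where "\<R> = Sigma \<B> \<D>"
  show thesis
  proof
    show "countable \<R>"
      unfolding \<R>_def using \<B>(1) \<D>(1) by (rule countable_SIGMA)
    show ref: "openin X A \<and> openin Y B \<and> (\<exists>U\<in>\<U>. A \<times> B \<subseteq> U)" if "(A, B) \<in> \<R>" for A B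
      using that \<D>(2)[of A] \<B>(2) by (auto simp: \<R>_def \<C>_def)
    show "(\<Union>(A, B)\<in>\<R>. A \<times> B) = \<Union>\<U>"
    proof
      show "(\<Union>(A, B)\<in>\<R>. A \<times> B) \<subseteq> \<Union>\<U>"
        using ref by blast
      show "\<Union>\<U> \<subseteq> (\<Union>(A, B)\<in>\<R>. A \<times> B)"
      proof clarify
        fix x y U assume U: "(x, y) \<in> U" "U \<in> \<U>"
        then obtain A B where AB: "openin X A" "openin Y B" "x \<in> A" "y \<in> B" "A \<times> B \<subseteq> U"
          using op[OF U(2)] unfolding openin_prod_topology_alt by metis
        then obtain A' where A': "A' \<in> \<B>" "x \<in> A'" "A' \<subseteq> A"
          using \<B>(3) by metis
        then have "B \<in> \<C> A'"
          using AB U by (auto simp: \<C>_def)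
        then have "y \<in> \<Union>(\<D> A')"
          using AB(4) \<D>(3) by blast
        then show "(x, y) \<in> (\<Union>(A, B)\<in>\<R>. A \<times> B)"
          using A' by (auto simp: \<R>_def)
      qed
    qed
  qed
qed

lemma hereditarily_Lindelof_prod_topology:
  assumes "second_countable X" "hereditarily Lindelof_space Y"
  shows "hereditarily Lindelof_space (prod_topology X Y)"
  unfolding hereditarily_Lindelof_iff
proof (intro allI impI)
  fix \<U> assume "\<forall>U\<in>\<U>. openin (prod_topology X Y) U"
  then obtain \<R> where R: "countable \<R>" "\<And>A B. (A, B) \<in> \<R> \<Longrightarrow> \<exists>U\<in>\<U>. A \<times> B \<subseteq> U"
    "(\<Union>(A, B)\<in>\<R>. A \<times> B) = \<Union>\<U>"
    using countable_rectangle_refinement[OF assms, of \<U>] by metis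
  then have "\<forall>r\<in>\<R>. \<exists>U. U \<in> \<U> \<and> fst r \<times> snd r \<subseteq> U"
    by (metis prod.collapse)
  then obtain u where u: "\<And>r. r \<in> \<R> \<Longrightarrow> u r \<in> \<U> \<and> fst r \<times> snd r \<subseteq> u r"
    by metis
  have "\<Union>\<U> \<subseteq> \<Union>(u ` \<R>)"
    unfolding R(3)[symmetric] using u by fastforce
  moreover have "u ` \<R> \<subseteq> \<U>"
    using u by auto
  ultimately show "\<exists>\<V>. countable \<V> \<and> \<V> \<subseteq> \<U> \<and> \<Union>\<V> = \<Union>\<U>"
    using R(1) by (intro exI[of _ "u ` \<R>"]) auto
qed

section \<open>Selections from sequences of covers\<close>

lemma Menger_spaceD:
  fixes \<U> :: "nat \<Rightarrow> 'a set set"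
  assumes "Menger_space X" "\<And>n. open_cover X (\<U> n)"
  shows "\<exists>\<F>. (\<forall>n. finite (\<F> n) \<and> \<F> n \<subseteq> \<U> n) \<and> (\<forall>x\<in>topspace X. {n. x \<in> \<Union>(\<F> n)} \<noteq> {})"
  using assms(1)[unfolded Menger_space_def, THEN spec, of \<U>] assms(2) by blast

lemma Hurewicz_spaceD:
  fixes \<U> :: "nat \<Rightarrow> 'a set set"
  assumes "Hurewicz_space X" "\<And>n. open_cover X (\<U> n)"
  shows "\<exists>\<F>. (\<forall>n. finite (\<F> n) \<and> \<F> n \<subseteq> \<U> n) \<and> (\<forall>x\<in>topspace X. finite (- {n. x \<in> \<Union>(\<F> n)}))"
  using assms(1)[unfolded Hurewicz_space_def, THEN spec, of \<U>] assms(2) by blast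

text \<open>A pairing of indices splits the covers into infinitely many sequences, and the Menger
  property is applied to each. The sequence with first index \<open>m\<close> catches
  \<open>x\<close> at a position at least \<open>m\<close>, so the hits are unbounded.\<close>

lemma Menger_space_infinitely_often:
  fixes \<U> :: "nat \<Rightarrow> 'a set set"
  assumes X: "Menger_space X" and cov: "\<And>n. open_cover X (\<U> n)"
  shows "\<exists>\<F>. (\<forall>n. finite (\<F> n) \<and> \<F> n \<subseteq> \<U> n) \<and> (\<forall>x\<in>topspace X. \<exists>\<^sub>\<infinity>n. x \<in> \<Union>(\<F> n))"
proof -
  have "\<forall>i. \<exists>\<F>. (\<forall>j. finite (\<F> j) \<and> \<F> j \<subseteq> \<U> (prod_encode (i, j))) \<and>
        (\<forall>x\<in>topspace X. {j. x \<in> \<Union>(\<F> j)} \<noteq> {})"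
    using X cov by (simp add: Menger_space_def)
  then obtain \<G> where G: "\<And>i j. finite (\<G> i j) \<and> \<G> i j \<subseteq> \<U> (prod_encode (i, j))"
    "\<And>i x. x \<in> topspace X \<Longrightarrow> {j. x \<in> \<Union>(\<G> i j)} \<noteq> {}"
    by metis
  define \<F> where "\<F> n = (case prod_decode n of (i, j) \<Rightarrow> \<G> i j)" for n
  show ?thesis
  proof (intro exI[of _ \<F>] conjI allI ballI)
    show "finite (\<F> n)" "\<F> n \<subseteq> \<U> n" for n
      using G(1)[of "fst (prod_decode n)" "snd (prod_decode n)"]
      by (simp_all add: \<F>_def case_prod_beta)
    show "\<exists>\<^sub>\<infinity>n. x \<in> \<Union>(\<F> n)" if "x \<in> topspace X" for x
      unfolding INFM_nat_le
    proof
      fix m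
      have "\<exists>j. x \<in> \<Union>(\<G> m j)"
        using G(2)[OF that, of m] by blast
      then obtain j where "x \<in> \<Union>(\<G> m j)" ..
      then show "\<exists>n\<ge>m. x \<in> \<Union>(\<F> n)"
        by (intro exI[of _ "prod_encode (m, j)"]) (auto simp: \<F>_def le_prod_encode_1)
    qed
  qed
qed

lemma finite_subset_range_mono:
  fixes U :: "nat \<Rightarrow> 'a set"
  assumes "mono U" "finite \<F>" "\<F> \<subseteq> range U"
  shows "\<exists>m. \<Union>\<F> \<subseteq> U m"
proof -
  obtain M where M: "finite M" "\<F> = U ` M"
    using assms(2,3) by (metis finite_subset_image)
  have "U i \<subseteq> U (Max M)" if "i \<in> M" for i
    using assms(1) M(1) that by (simp add: monoD)
  then show ?thesis
    using M(2) by blast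
qed

text \<open>A finite subfamily of an increasing sequence lies below one member, so a selection
  reduces to a function \<open>g\<close>. Having infinitely many hits allows \<open>g\<close> to be
  compared later with functions that dominate it only eventually.\<close>

lemma Menger_space_seqD:
  assumes X: "Menger_space X" and op: "\<And>n m. openin X (U n m)" and mono: "\<And>n. mono (U n)"
    and cov: "\<And>n x. x \<in> topspace X \<Longrightarrow> \<exists>m. x \<in> U n m"
  obtains g :: "nat \<Rightarrow> nat" where "\<And>x. x \<in> topspace X \<Longrightarrow> \<exists>\<^sub>\<infinity>n. x \<in> U n (g n)"
proof -
  have cover: "open_cover X (range (U n))" for n
    using op[of n] cov[of _ n] openin_subset by (fastforce simp: open_cover_def)
  obtain \<F> where F': "\<forall>n. finite (\<F> n) \<and> \<F> n \<subseteq> range (U n)"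
    "\<forall>x\<in>topspace X. \<exists>\<^sub>\<infinity>n. x \<in> \<Union>(\<F> n)"
    using Menger_space_infinitely_often[OF X, of "\<lambda>n. range (U n)", OF cover]
    by (elim exE conjE) (rule that)
  note F = F'(1)[THEN spec, THEN conjunct1] F'(1)[THEN spec, THEN conjunct2] F'(2)[THEN bspec]
  obtain g where g: "\<And>n. \<Union>(\<F> n) \<subseteq> U n (g n)"
    using finite_subset_range_mono[OF mono F(1,2)] by metis
  show thesis
    using F(3) g by (intro that[of g]) (blast intro: INFM_mono)
qed

lemma Hurewicz_space_seqD:
  assumes X: "Hurewicz_space X" and op: "\<And>n m. openin X (U n m)" and mono: "\<And>n. mono (U n)"
    and cov: "\<And>n x. x \<in> topspace X \<Longrightarrow> \<exists>m. x \<in> U n m"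
  obtains g :: "nat \<Rightarrow> nat" where "\<And>x. x \<in> topspace X \<Longrightarrow> \<forall>\<^sub>\<infinity>n. x \<in> U n (g n)"
proof -
  have cover: "open_cover X (range (U n))" for n
    using op[of n] cov[of _ n] openin_subset by (fastforce simp: open_cover_def)
  obtain \<F> where F': "\<forall>n. finite (\<F> n) \<and> \<F> n \<subseteq> range (U n)"
    "\<forall>x\<in>topspace X. finite (- {n. x \<in> \<Union>(\<F> n)})"
    using Hurewicz_spaceD[OF X, of "\<lambda>n. range (U n)", OF cover]
    by (elim exE conjE) (rule that)
  note F = F'(1)[THEN spec, THEN conjunct1] F'(1)[THEN spec, THEN conjunct2] F'(2)[THEN bspec]
  obtain g where g: "\<And>n. \<Union>(\<F> n) \<subseteq> U n (g n)"
    using finite_subset_range_mono[OF mono F(1,2)] by metis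
  have "\<forall>\<^sub>\<infinity>n. x \<in> U n (g n)" if "x \<in> topspace X" for x
  proof -
    have "\<forall>\<^sub>\<infinity>n. x \<in> \<Union>(\<F> n)"
      using F(3)[OF that] unfolding eventually_cofinite Collect_neg_eq .
    then show ?thesis
      using g by (auto elim!: eventually_mono)
  qed
  then show thesis ..
qed

lemma finite_subfamily_of_refinement:
  fixes g :: nat
  assumes "\<And>m. \<exists>U\<in>\<U>. V m \<subseteq> U"
  shows "\<exists>\<F>. finite \<F> \<and> \<F> \<subseteq> \<U> \<and> (\<Union>m\<le>g. V m) \<subseteq> \<Union>\<F>"
proof -
  obtain u where "\<And>m. u m \<in> \<U> \<and> V m \<subseteq> u m"
    using assms by metis
  then show ?thesis
    by (intro exI[of _ "u ` {..g}"]) auto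
qed

text \<open>A member of \<open>\<U> n\<close> is chosen above each \<open>V n m\<close>, so a bound
  on \<open>m\<close> becomes a finite subfamily. Empty spaces are settled here, so that later the
  refining families are nonempty and can be listed as sequences.\<close>

lemma Hurewicz_spaceI_refinement:
  assumes "\<And>\<U>. (\<And>n. open_cover X (\<U> n)) \<Longrightarrow> topspace X \<noteq> {} \<Longrightarrow>
      \<exists>V (g :: nat \<Rightarrow> nat). (\<forall>n m. \<exists>U\<in>\<U> n. V n m \<subseteq> U) \<and>
        (\<forall>x\<in>topspace X. \<forall>\<^sub>\<infinity>n. \<exists>m\<le>g n. x \<in> V n m)"
  shows "Hurewicz_space X"
  unfolding Hurewicz_space_def
proof (intro allI impI)
  fix \<U> :: "nat \<Rightarrow> 'a set set" assume cov: "\<forall>n. open_cover X (\<U> n)"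
  show "\<exists>\<F>. (\<forall>n. finite (\<F> n) \<and> \<F> n \<subseteq> \<U> n) \<and>
      (\<forall>x\<in>topspace X. finite (- {n. x \<in> \<Union>(\<F> n)}))"
  proof (cases "topspace X = {}")
    case True
    then show ?thesis by (intro exI[of _ "\<lambda>_. {}"]) simp
  next
    case False
    obtain V and g :: "nat \<Rightarrow> nat" where V: "\<And>n m. \<exists>U\<in>\<U> n. V n m \<subseteq> U"
      "\<And>x. x \<in> topspace X \<Longrightarrow> \<forall>\<^sub>\<infinity>n. \<exists>m\<le>g n. x \<in> V n m"
      using assms[of \<U>, OF _ False] cov by blast
    have "\<exists>\<F>. finite \<F> \<and> \<F> \<subseteq> \<U> n \<and> (\<Union>m\<le>g n. V n m) \<subseteq> \<Union>\<F>" for n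
      by (rule finite_subfamily_of_refinement) (rule V(1))
    then obtain \<F> where F: "\<And>n. finite (\<F> n)" "\<And>n. \<F> n \<subseteq> \<U> n"
      "\<And>n. (\<Union>m\<le>g n. V n m) \<subseteq> \<Union>(\<F> n)"
      by metis
    have "finite (- {n. x \<in> \<Union>(\<F> n)})" if "x \<in> topspace X" for x
    proof -
      have "\<forall>\<^sub>\<infinity>n. x \<in> \<Union>(\<F> n)"
        using V(2)[OF that] by (rule eventually_mono) (use F(3) in blast)
      then show ?thesis
        unfolding eventually_cofinite Collect_neg_eq .
    qed
    with F(1,2) show ?thesis
      by (intro exI[of _ \<F>]) simp
  qed
qed

text \<open>A converse of \<open>Menger_space_seqD\<close> for Lindelof spaces: a countable subcover
  is listed and replaced by the unions of its initial parts.\<close>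

lemma Menger_spaceI_seq:
  assumes X: "Lindelof_space X"
    and g: "\<And>U. (\<And>n m. openin X (U n m)) \<Longrightarrow> (\<And>n. mono (U n)) \<Longrightarrow>
      (\<And>n x. x \<in> topspace X \<Longrightarrow> \<exists>m. x \<in> U n m) \<Longrightarrow>
      \<exists>g :: nat \<Rightarrow> nat. \<forall>x\<in>topspace X. \<exists>n. x \<in> U n (g n)"
  shows "Menger_space X"
  unfolding Menger_space_def
proof (intro allI impI)
  fix \<U> :: "nat \<Rightarrow> 'a set set" assume cov: "\<forall>n. open_cover X (\<U> n)"
  show "\<exists>\<F>. (\<forall>n. finite (\<F> n) \<and> \<F> n \<subseteq> \<U> n) \<and>
      (\<forall>x\<in>topspace X. {n. x \<in> \<Union>(\<F> n)} \<noteq> {})"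
  proof (cases "topspace X = {}")
    case True
    then show ?thesis by (intro exI[of _ "\<lambda>_. {}"]) simp
  next
    case False
    have "\<exists>\<V>. countable \<V> \<and> \<V> \<subseteq> \<U> n \<and> \<Union>\<V> = topspace X" for n
      using cov X by (intro Lindelof_spaceD) (auto simp: open_cover_def)
    then obtain \<V> where V: "\<And>n. countable (\<V> n)" "\<And>n. \<V> n \<subseteq> \<U> n" "\<And>n. \<Union>(\<V> n) = topspace X"
      by metis
    define v where "v n = from_nat_into (\<V> n)" for n
    have "\<V> n \<noteq> {}" for n
      using V(3)[of n] False by (metis Union_empty)
    then have v: "range (v n) = \<V> n" for n
      by (simp add: v_def V(1) range_from_nat_into)
    define U where "U n m = (\<Union>i\<le>m. v n i)" for n m
    have vU: "v n i \<in> \<U> n" for n i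
      using v V(2) by blast
    have "\<exists>g :: nat \<Rightarrow> nat. \<forall>x\<in>topspace X. \<exists>n. x \<in> U n (g n)"
    proof (rule g)
      show "openin X (U n m)" for n m
        unfolding U_def using vU cov by (intro openin_Union) (auto simp: open_cover_def)
      show "mono (U n)" for n
        unfolding U_def by (rule monoI) force
      show "\<exists>m. x \<in> U n m" if "x \<in> topspace X" for n x
        using that unfolding V(3)[of n, symmetric] v[symmetric] U_def by auto
    qed
    then obtain g where "\<And>x. x \<in> topspace X \<Longrightarrow> \<exists>n. x \<in> U n (g n)"
      by blast
    then show ?thesis
      using vU by (intro exI[of _ "\<lambda>n. v n ` {..g n}"]) (fastforce simp: U_def)
  qed
qed

section \<open>Continuous images\<close>

lemma open_cover_preimage:
  assumes f: "continuous_map X Y f" and cov: "open_cover Y \<U>"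
  shows "open_cover X ((\<lambda>U. {x \<in> topspace X. f x \<in> U}) ` \<U>)"
  unfolding open_cover_def
proof
  show "\<forall>V\<in>(\<lambda>U. {x \<in> topspace X. f x \<in> U}) ` \<U>. openin X V"
    using cov by (auto simp: open_cover_def intro: openin_continuous_map_preimage[OF f])
  have "f x \<in> \<Union>\<U>" if "x \<in> topspace X" for x
    using cov continuous_map_image_subset_topspace[OF f] that by (auto simp: open_cover_def)
  then show "\<Union>((\<lambda>U. {x \<in> topspace X. f x \<in> U}) ` \<U>) = topspace X"
    by blast
qed

lemma Menger_space_continuous_map_image:
  assumes X: "Menger_space X" and f: "continuous_map X Y f" and im: "f ` topspace X = topspace Y"
  shows "Menger_space Y"
  unfolding Menger_space_def
proof (intro allI impI)
  fix \<U> :: "nat \<Rightarrow> 'b set set" assume cov: "\<forall>n. open_cover Y (\<U> n)"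
  define pre where "pre U = {x \<in> topspace X. f x \<in> U}" for U
  have cover: "open_cover X (pre ` \<U> n)" for n
    using open_cover_preimage[OF f, of "\<U> n"] cov unfolding pre_def by blast
  obtain \<F> where F': "\<forall>n. finite (\<F> n) \<and> \<F> n \<subseteq> pre ` \<U> n"
    "\<forall>x\<in>topspace X. {n. x \<in> \<Union>(\<F> n)} \<noteq> {}"
    using Menger_spaceD[OF X, of "\<lambda>n. pre ` \<U> n", OF cover]
    by (elim exE conjE) (rule that)
  note F = F'(1)[THEN spec, THEN conjunct1] F'(1)[THEN spec, THEN conjunct2] F'(2)[THEN bspec]
  have "\<exists>\<G>. \<G> \<subseteq> \<U> n \<and> finite \<G> \<and> \<F> n = pre ` \<G>" for n
    using F(1,2)[of n] by (rule finite_subset_image)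
  then obtain \<G> where G: "\<And>n. \<G> n \<subseteq> \<U> n" "\<And>n. finite (\<G> n)" "\<And>n. \<F> n = pre ` \<G> n"
    by metis
  have "{n. y \<in> \<Union>(\<G> n)} \<noteq> {}" if "y \<in> topspace Y" for y
  proof -
    have "y \<in> f ` topspace X"
      using that im by simp
    then obtain x where x: "x \<in> topspace X" "f x = y" by blast
    then have "{n. x \<in> \<Union>(\<F> n)} \<subseteq> {n. y \<in> \<Union>(\<G> n)}"
      unfolding G(3) by (auto simp: pre_def)
    then show ?thesis using F(3)[OF x(1)] by (metis subset_empty)
  qed
  with G show "\<exists>\<F>. (\<forall>n. finite (\<F> n) \<and> \<F> n \<subseteq> \<U> n) \<and>
      (\<forall>x\<in>topspace Y. {n. x \<in> \<Union>(\<F> n)} \<noteq> {})"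
    by (intro exI[of _ \<G>]) simp
qed

lemma Hurewicz_space_continuous_map_image:
  assumes X: "Hurewicz_space X" and f: "continuous_map X Y f" and im: "f ` topspace X = topspace Y"
  shows "Hurewicz_space Y"
  unfolding Hurewicz_space_def
proof (intro allI impI)
  fix \<U> :: "nat \<Rightarrow> 'b set set" assume cov: "\<forall>n. open_cover Y (\<U> n)"
  define pre where "pre U = {x \<in> topspace X. f x \<in> U}" for U
  have cover: "open_cover X (pre ` \<U> n)" for n
    using open_cover_preimage[OF f, of "\<U> n"] cov unfolding pre_def by blast
  obtain \<F> where F': "\<forall>n. finite (\<F> n) \<and> \<F> n \<subseteq> pre ` \<U> n"
    "\<forall>x\<in>topspace X. finite (- {n. x \<in> \<Union>(\<F> n)})"
    using Hurewicz_spaceD[OF X, of "\<lambda>n. pre ` \<U> n", OF cover]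
    by (elim exE conjE) (rule that)
  note F = F'(1)[THEN spec, THEN conjunct1] F'(1)[THEN spec, THEN conjunct2] F'(2)[THEN bspec]
  have "\<exists>\<G>. \<G> \<subseteq> \<U> n \<and> finite \<G> \<and> \<F> n = pre ` \<G>" for n
    using F(1,2)[of n] by (rule finite_subset_image)
  then obtain \<G> where G: "\<And>n. \<G> n \<subseteq> \<U> n" "\<And>n. finite (\<G> n)" "\<And>n. \<F> n = pre ` \<G> n"
    by metis
  have "finite (- {n. y \<in> \<Union>(\<G> n)})" if "y \<in> topspace Y" for y
  proof -
    have "y \<in> f ` topspace X"
      using that im by simp
    then obtain x where x: "x \<in> topspace X" "f x = y" by blast
    then have "- {n. y \<in> \<Union>(\<G> n)} \<subseteq> - {n. x \<in> \<Union>(\<F> n)}"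
      unfolding G(3) by (auto simp: pre_def)
    then show ?thesis
      using F(3)[OF x(1)] by (rule finite_subset)
  qed
  with G show "\<exists>\<F>. (\<forall>n. finite (\<F> n) \<and> \<F> n \<subseteq> \<U> n) \<and>
      (\<forall>x\<in>topspace Y. finite (- {n. x \<in> \<Union>(\<F> n)}))"
    by (intro exI[of _ \<G>]) simp
qed

section \<open>Families of functions of size less than b\<close>

text \<open>The summand \<open>Suc\<close> makes the function strictly increasing, so that it is the
  increasing enumeration of its range.\<close>

definition majorant :: "(nat \<Rightarrow> nat) \<Rightarrow> nat \<Rightarrow> nat" where
  "majorant f n = (\<Sum>k\<le>n. Suc (f k))"

lemma strict_mono_majorant: "strict_mono (majorant f)"
  by (rule strict_monoI_Suc) (simp add: majorant_def)

lemma majorant_ge: "f n \<le> majorant f n"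
proof -
  have "Suc (f n) \<le> (\<Sum>k\<le>n. Suc (f k))"
    by (rule member_le_sum) auto
  then show ?thesis by (simp add: majorant_def)
qed

lemma enumerate_range:
  fixes s :: "nat \<Rightarrow> nat"
  assumes "strict_mono s"
  shows "enumerate (range s) n = s n"
proof (induction n)
  case 0
  have "(LEAST k. k \<in> range s) = s 0"
    using assms by (intro Least_equality) (auto simp: strict_mono_less_eq)
  then show ?case by (simp add: enumerate_0)
next
  case (Suc n)
  have inf: "infinite (range s)"
    using assms by (simp add: range_inj_infinite strict_mono_imp_inj_on)
  have "(LEAST k. k \<in> range s \<and> s n < k) = s (Suc n)"
    using assms by (intro Least_equality) (auto simp: strict_mono_less strict_mono_less_eq)
  then show ?case
    by (simp add: enumerate_Suc''[OF inf] Suc)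
qed

lemma le_star_iff: "a \<le>* b \<longleftrightarrow> (\<forall>\<^sub>\<infinity>n. enumerate a n \<le> enumerate b n)"
  by (simp add: le_star_def eventually_cofinite)

text \<open>This passes from functions to infinite sets, so that the cardinals b and d, defined by
  enumerations, also govern arbitrary functions.\<close>

lemma ex_infinite_subset_dominating:
  fixes f :: "nat \<Rightarrow> nat"
  obtains a where "a \<in> infinite_subsets" "\<And>n. f n \<le> enumerate a n"
proof
  let ?a = "range (majorant f)"
  show "?a \<in> infinite_subsets"
    using strict_mono_majorant[of f]
    by (simp add: infinite_subsets_def range_inj_infinite strict_mono_imp_inj_on)
  show "f n \<le> enumerate ?a n" for n
    by (simp add: enumerate_range strict_mono_majorant majorant_ge)
qed

lemma bounded_if_card_less_frak_b:
  fixes h :: "'i \<Rightarrow> nat \<Rightarrow> nat"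
  assumes "|I| <o frak_b"
  obtains g where "\<And>i. i \<in> I \<Longrightarrow> \<forall>\<^sub>\<infinity>n. h i n \<le> g n"
proof -
  have "\<exists>a. a \<in> infinite_subsets \<and> (\<forall>n. h i n \<le> enumerate a n)" for i
    using ex_infinite_subset_dominating[of "h i"] by blast
  then obtain T where T: "\<And>i. T i \<in> infinite_subsets" "\<And>i n. h i n \<le> enumerate (T i) n"
    by metis
  have "|T ` I| <o frak_b"
    using card_of_image assms by (rule ordLeq_ordLess_trans)
  then have "\<not> unbounded_family (T ` I)"
    using frak_b(2) not_ordLess_ordLeq by blast
  then obtain b where b: "\<And>i. i \<in> I \<Longrightarrow> T i \<le>* b"
    using T(1) by (auto simp: unbounded_family_def)
  have "\<forall>\<^sub>\<infinity>n. h i n \<le> enumerate b n" if "i \<in> I" for i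
    using b[OF that] unfolding le_star_iff
    by (rule eventually_mono) (use T(2) order_trans in blast)
  then show thesis ..
qed

text \<open>The diagonal sum contains \<open>g i n\<close> as a summand as soon as
  \<open>n \<ge> i\<close>.\<close>

lemma countable_family_bounded:
  fixes g :: "nat \<Rightarrow> nat \<Rightarrow> nat"
  obtains h where "\<And>i. \<forall>\<^sub>\<infinity>n. g i n \<le> h n"
proof
  fix i
  show "\<forall>\<^sub>\<infinity>n. g i n \<le> (\<Sum>j\<le>n. g j n)"
    unfolding MOST_nat_le
    by (intro exI[of _ i] allI impI member_le_sum) auto
qed

section \<open>An embedding of the Cantor space into the real line\<close>

text \<open>A ternary expansion with digits 0 and 1. All digits after position \<open>k\<close>
  together contribute at most half the weight of position \<open>k\<close>, so distinct sets stay
  apart. It turns families of sets of naturals into real sets.\<close>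

definition cantor_real :: "nat set \<Rightarrow> real" where
  "cantor_real A = (\<Sum>k. of_bool (k \<in> A) * (1/3)^k)"

lemma summable_cantor_real: "summable (\<lambda>k. of_bool (k \<in> A) * (1/3::real)^k)"
  by (rule summable_comparison_test'[where g = "\<lambda>k. (1/3)^k" and N = 0])
    (auto simp: summable_geometric)

lemma cantor_real_bounds: "0 \<le> cantor_real A" "cantor_real A \<le> 3/2"
proof -
  show "0 \<le> cantor_real A"
    unfolding cantor_real_def by (intro suminf_nonneg summable_cantor_real) simp
  have "cantor_real A \<le> (\<Sum>k. (1/3::real)^k)"
    unfolding cantor_real_def
    by (intro suminf_le summable_cantor_real summable_geometric) auto
  also have "\<dots> = 3/2"
    by (subst suminf_geometric) auto
  finally show "cantor_real A \<le> 3/2" .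
qed

lemma cantor_real_split:
  "cantor_real A = (\<Sum>k<n. of_bool (k \<in> A) * (1/3)^k) + (1/3)^n * cantor_real {k. k + n \<in> A}"
proof -
  have "cantor_real A = (\<Sum>k. of_bool (k + n \<in> A) * (1/3)^(k + n)) +
      (\<Sum>k<n. of_bool (k \<in> A) * (1/3)^k)"
    unfolding cantor_real_def by (rule suminf_split_initial_segment[OF summable_cantor_real])
  also have "(\<Sum>k. of_bool (k + n \<in> A) * (1/3::real)^(k + n)) =
      (\<Sum>k. (1/3)^n * (of_bool (k \<in> {k. k + n \<in> A}) * (1/3)^k))"
    by (simp add: power_add mult_ac)
  also have "\<dots> = (1/3)^n * cantor_real {k. k + n \<in> A}"
    unfolding cantor_real_def by (rule suminf_mult[OF summable_cantor_real])
  finally show ?thesis by simp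
qed

lemma cantor_real_close:
  assumes "A \<inter> {..<n} = B \<inter> {..<n}"
  shows "dist (cantor_real A) (cantor_real B) \<le> 3/2 * (1/3)^n"
proof -
  have "(\<Sum>k<n. of_bool (k \<in> A) * (1/3::real)^k) = (\<Sum>k<n. of_bool (k \<in> B) * (1/3)^k)"
    using assms by (intro sum.cong) (auto simp: set_eq_iff)
  then have "dist (cantor_real A) (cantor_real B) =
      (1/3)^n * \<bar>cantor_real {k. k + n \<in> A} - cantor_real {k. k + n \<in> B}\<bar>"
    by (subst (1 2) cantor_real_split[of _ n])
      (simp add: dist_real_def abs_mult flip: right_diff_distrib)
  also have "\<dots> \<le> (1/3)^n * (3/2)"
    using cantor_real_bounds[of "{k. k + n \<in> A}"] cantor_real_bounds[of "{k. k + n \<in> B}"]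
    by (intro mult_left_mono) (simp_all only: abs_le_iff, linarith, simp)
  finally show ?thesis by (simp add: mult.commute)
qed

text \<open>The first difference contributes \<open>(1/3)^k\<close>, and the later digits can cancel
  at most \<open>(1/3)^Suc k * (3/2)\<close>, which is half of it.\<close>

lemma cantor_real_separated:
  assumes "k \<in> A" "k \<notin> B" "A \<inter> {..<k} = B \<inter> {..<k}"
  shows "(1/3)^k / 2 \<le> dist (cantor_real A) (cantor_real B)"
proof -
  have "(\<Sum>j<k. of_bool (j \<in> A) * (1/3::real)^j) = (\<Sum>j<k. of_bool (j \<in> B) * (1/3)^j)"
    using assms by (intro sum.cong) (auto simp: set_eq_iff)
  then have "cantor_real A - cantor_real B = (1/3)^k +
      (1/3)^Suc k * (cantor_real {j. j + Suc k \<in> A} - cantor_real {j. j + Suc k \<in> B})"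
    using assms(1,2)
    by (subst (1 2) cantor_real_split[of _ "Suc k"]) (simp add: right_diff_distrib)
  also have "\<dots> \<ge> (1/3)^k + (1/3)^Suc k * (- (3/2))"
    using cantor_real_bounds[of "{j. j + Suc k \<in> A}"] cantor_real_bounds[of "{j. j + Suc k \<in> B}"]
    by (intro add_left_mono mult_left_mono) auto
  finally have "(1/3)^k / 2 \<le> cantor_real A - cantor_real B" by simp
  then show ?thesis unfolding dist_real_def by linarith
qed

text \<open>Otherwise \<open>cantor_real_separated\<close> applies at the least position of
  disagreement. With \<open>cantor_real_close\<close> this makes \<open>cantor_real\<close> a
  homeomorphism onto its image.\<close>

lemma cantor_real_agree:
  assumes "dist (cantor_real A) (cantor_real B) < (1/3)^n / 2"
  shows "A \<inter> {..n} = B \<inter> {..n}"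
proof (rule ccontr)
  assume "A \<inter> {..n} \<noteq> B \<inter> {..n}"
  then have ex: "\<exists>k. k \<le> n \<and> (k \<in> A \<longleftrightarrow> k \<notin> B)" by auto
  define k where "k = (LEAST k. k \<le> n \<and> (k \<in> A \<longleftrightarrow> k \<notin> B))"
  have k: "k \<le> n" "k \<in> A \<longleftrightarrow> k \<notin> B"
    using LeastI_ex[OF ex] unfolding k_def by blast+
  have "j \<in> A \<longleftrightarrow> j \<in> B" if "j < k" for j
    using not_less_Least[of j "\<lambda>k. k \<le> n \<and> (k \<in> A \<longleftrightarrow> k \<notin> B)"] that k(1)
    unfolding k_def[symmetric] by auto
  then have "A \<inter> {..<k} = B \<inter> {..<k}" by auto
  then have "(1/3)^k / 2 \<le> dist (cantor_real A) (cantor_real B)"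
    using cantor_real_separated[of k A B] cantor_real_separated[of k B A] k(2)
    by (auto simp: dist_commute)
  moreover have "(1/3)^n \<le> (1/3::real)^k"
    using k(1) by (intro power_decreasing) auto
  ultimately show False using assms by linarith
qed

lemma inj_cantor_real: "inj cantor_real"
proof (rule injI)
  fix A B assume "cantor_real A = cantor_real B"
  then have "A \<inter> {..n} = B \<inter> {..n}" for n
    by (intro cantor_real_agree) simp
  then show "A = B"
    by (metis IntI Int_iff atMost_iff order_refl subsetI subset_antisym)
qed

section \<open>The product of a Hurewicz space and a concentrated set of reals\<close>

text \<open>The Hurewicz property of \<open>H\<close> yields one function that serves all points
  near the countable set \<open>D\<close>. The points of \<open>Y\<close> outside a neighbourhood of
  \<open>D\<close> number fewer than b, so the functions that serve them one by one have a common
  bound.\<close>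

lemma Hurewicz_imp_Menger_prod_concentrated:
  fixes Y :: "real set"
  assumes H: "Hurewicz_space H"
    and L: "Lindelof_space (prod_topology H (top_of_set Y))"
    and Y: "concentrated \<kappa> (top_of_set Y)"
    and \<kappa>: "\<kappa> \<le>o frak_b"
  shows "Menger_space (prod_topology H (top_of_set Y))"
proof (rule Menger_spaceI_seq[OF L])
  fix U :: "nat \<Rightarrow> nat \<Rightarrow> ('a \<times> real) set"
  assume op: "\<And>n m. openin (prod_topology H (top_of_set Y)) (U n m)"
    and mono: "\<And>n. mono (U n)"
    and "\<And>n x. x \<in> topspace (prod_topology H (top_of_set Y)) \<Longrightarrow> \<exists>m. x \<in> U n m"
  then have cov: "\<exists>m. (h, y) \<in> U n m" if "h \<in> topspace H" "y \<in> Y" for h y n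
    using that by simp
  obtain D where D: "D \<subseteq> Y" "countable D"
    "\<And>V. openin (top_of_set Y) V \<Longrightarrow> D \<subseteq> V \<Longrightarrow> |Y - V| <o \<kappa>"
    and card: "\<kappa> \<le>o |Y|"
    using Y unfolding concentrated_def by auto
  \<comment> \<open>Otherwise the empty open set would contain \<open>D\<close>, and
    \<open>Y\<close> itself would be smaller than \<open>\<kappa>\<close>.\<close>
  have "D \<noteq> {}"
    using D(3)[of "{}"] card not_ordLess_ordLeq by auto
  define d where "d = from_nat_into D"
  have d: "range d = D"
    using \<open>D \<noteq> {}\<close> D(2) by (simp add: d_def range_from_nat_into)
  define B where "B i m = ball (d i) (1 / real (Suc m)) \<inter> Y" for i m
  have B_anti: "B i m' \<subseteq> B i m" if "m \<le> m'" for i m m'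
  proof -
    have "1 / real (Suc m') \<le> 1 / real (Suc m)"
      using that by (simp add: frac_le)
    then show ?thesis
      unfolding B_def by (intro Int_mono subset_ball order_refl)
  qed
  \<comment> \<open>Stage \<open>n\<close> treats only the points \<open>d 0\<close> to
    \<open>d n\<close>, so a finite intersection of neighbourhoods and a maximum of indices serve
    them all. A larger \<open>m\<close> shrinks the balls and enlarges \<open>U n m\<close>, so
    \<open>A n\<close> is increasing.\<close>
  define A where "A n m = \<Union>{G. openin H G \<and> (\<forall>i\<le>n. G \<times> B i m \<subseteq> U n m)}" for n m
  have "\<exists>m. h \<in> A n m" if h: "h \<in> topspace H" for n h
  proof -
    have "\<exists>G m. openin H G \<and> h \<in> G \<and> G \<times> B i m \<subseteq> U n m" for i
    proof -
      have "d i \<in> Y"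
        using d D(1) by blast
      then obtain m where m: "(h, d i) \<in> U n m"
        using cov[OF h] by blast
      then obtain G V where GV: "openin H G" "openin (top_of_set Y) V" "h \<in> G" "d i \<in> V"
        "G \<times> V \<subseteq> U n m"
        using op[of n m] unfolding openin_prod_topology_alt by metis
      then obtain e where e: "e > 0" "ball (d i) e \<inter> Y \<subseteq> V"
        unfolding openin_contains_ball by blast
      obtain k where k: "1 / real (Suc k) < e"
        using e(1) by (meson nat_approx_posE)
      have "B i (max k m) \<subseteq> B i k"
        by (rule B_anti) simp
      also have "\<dots> \<subseteq> V"
        using e(2) k unfolding B_def by (meson Int_mono less_imp_le order_refl order_trans subset_ball)
      finally have "G \<times> B i (max k m) \<subseteq> G \<times> V"
        by blast
      also have "\<dots> \<subseteq> U n (max k m)"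
        using GV(5) monoD[OF mono[of n], of m "max k m"] by simp
      finally show ?thesis
        using GV(1,3) by blast
    qed
    then obtain G m where G: "\<And>i. openin H (G i)" "\<And>i. h \<in> G i" "\<And>i. G i \<times> B i (m i) \<subseteq> U n (m i)"
      by metis
    define M where "M = Max (m ` {..n})"
    have "(\<Inter>i\<le>n. G i) \<times> B i M \<subseteq> U n M" if "i \<le> n" for i
    proof -
      have "m i \<le> M"
        using that by (simp add: M_def)
      then have "U n (m i) \<subseteq> U n M" "B i M \<subseteq> B i (m i)"
        using mono[of n] B_anti by (auto dest: monoD)
      then show ?thesis
        using G(3)[of i] that by blast
    qed
    moreover have "openin H (\<Inter>i\<le>n. G i)"
      using G(1) by (intro openin_Inter) auto
    ultimately show ?thesis
      using G(2) unfolding A_def by (intro exI[of _ M] UnionI[of "\<Inter>i\<le>n. G i"]) auto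
  qed
  moreover have "openin H (A n m)" for n m
    unfolding A_def by blast
  moreover have "mono (A n)" for n
  proof (rule monoI)
    fix m m' :: nat assume "m \<le> m'"
    then have "U n m \<subseteq> U n m'" "\<And>i. B i m' \<subseteq> B i m"
      using mono[of n] B_anti by (auto dest: monoD)
    then show "A n m \<subseteq> A n m'"
      unfolding A_def by (intro Union_mono Collect_mono) (blast dest: order_trans)
  qed
  ultimately obtain g where g: "\<And>h. h \<in> topspace H \<Longrightarrow> \<forall>\<^sub>\<infinity>n. h \<in> A n (g n)"
    using Hurewicz_space_seqD[OF H, of A] by blast
  \<comment> \<open>A neighbourhood of \<open>D\<close> with radii prescribed by \<open>g\<close>:
    the point \<open>d i\<close> is caught at stage \<open>max i N\<close>. Hence fewer than
    \<open>\<kappa>\<close> points of \<open>Y\<close> lie outside \<open>V N\<close>.\<close>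
  define V where "V N = (\<Union>n\<in>{N..}. \<Union>i\<le>n. B i (g n))" for N
  have V: "openin (top_of_set Y) (V N)" "D \<subseteq> V N" for N
  proof -
    have "openin (top_of_set Y) (B i m)" for i m
      unfolding B_def by (metis inf_commute open_ball openin_open_Int)
    then show "openin (top_of_set Y) (V N)"
      unfolding V_def by (intro openin_Union) auto
    show "D \<subseteq> V N"
    proof
      fix x assume "x \<in> D"
      then obtain i where "x = d i"
        using d by blast
      then have "x \<in> B i (g (max i N))"
        using \<open>x \<in> D\<close> D(1) by (auto simp: B_def)
      then show "x \<in> V N"
        unfolding V_def by (intro UN_I[of "max i N"] UN_I[of i]) auto
    qed
  qed
  \<comment> \<open>For fixed \<open>y\<close> the sections of \<open>U n m\<close> form increasing
    open covers of \<open>H\<close>, so one function serves all \<open>h\<close>.\<close>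
  have "\<exists>g. \<forall>h\<in>topspace H. \<forall>\<^sub>\<infinity>n. (h, y) \<in> U n (g n)" if "y \<in> Y" for y
  proof -
    have "openin H {h \<in> topspace H. (h, y) \<in> U n m}" for n m
      by (rule openin_continuous_map_preimage[OF _ op[of n m]])
        (use that in \<open>simp add: continuous_map_pairedI\<close>)
    moreover have "mono (\<lambda>m. {h \<in> topspace H. (h, y) \<in> U n m})" for n
      using mono[of n] by (auto simp: mono_def)
    moreover have "\<exists>m. h \<in> {h \<in> topspace H. (h, y) \<in> U n m}" if "h \<in> topspace H" for n h
      using cov[OF that \<open>y \<in> Y\<close>] that by simp
    ultimately show ?thesis
      using Hurewicz_space_seqD[OF H, of "\<lambda>n m. {h \<in> topspace H. (h, y) \<in> U n m}"]
      by (smt (verit, best) eventually_mono mem_Collect_eq)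
  qed
  then obtain p where p: "\<And>y h. y \<in> Y \<Longrightarrow> h \<in> topspace H \<Longrightarrow> \<forall>\<^sub>\<infinity>n. (h, y) \<in> U n (p y n)"
    by metis
  \<comment> \<open>For each \<open>N\<close> fewer than b functions \<open>p y\<close> have to be
    bounded. The countably many bounds are then absorbed into the single function
    \<open>q\<close>.\<close>
  have "\<exists>G. \<forall>y\<in>Y - V N. \<forall>\<^sub>\<infinity>n. p y n \<le> G n" for N
  proof -
    have "|Y - V N| <o frak_b"
      using D(3)[OF V] \<kappa> by (rule ordLess_ordLeq_trans)
    then show ?thesis
      by (rule bounded_if_card_less_frak_b[of "Y - V N" p]) blast
  qed
  then obtain G where G: "\<And>N y. y \<in> Y - V N \<Longrightarrow> \<forall>\<^sub>\<infinity>n. p y n \<le> G N n"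
    by metis
  obtain q where q: "\<And>N. \<forall>\<^sub>\<infinity>n. G N n \<le> q n"
    using countable_family_bounded[of G] by blast
  \<comment> \<open>If \<open>y\<close> lies in every \<open>V N\<close>, it lies in a ball of a
    stage so late that \<open>h \<in> A n (g n)\<close>, and \<open>g\<close> suffices. Otherwise
    \<open>y\<close> is outside some \<open>V N\<close>, and \<open>q\<close> suffices.\<close>
  have "\<exists>n. (h, y) \<in> U n (max (g n) (q n))" if h: "h \<in> topspace H" and y: "y \<in> Y" for h y
  proof (cases "\<forall>N. y \<in> V N")
    case True
    obtain N where N: "\<And>n. n \<ge> N \<Longrightarrow> h \<in> A n (g n)"
      using g[OF h] unfolding MOST_nat_le by blast
    obtain n i where n: "n \<ge> N" "i \<le> n" "y \<in> B i (g n)"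
      using True[rule_format, of N] unfolding V_def by auto
    then have "(h, y) \<in> U n (g n)"
      using N[OF n(1)] unfolding A_def by blast
    then show ?thesis
      using monoD[OF mono[of n], of "g n" "max (g n) (q n)"] by auto
  next
    case False
    then obtain N where "y \<in> Y - V N"
      using y by blast
    then have "\<forall>\<^sub>\<infinity>n. (h, y) \<in> U n (p y n) \<and> p y n \<le> G N n \<and> G N n \<le> q n"
      using p[OF y h] G q by (intro eventually_conj) auto
    then obtain n where "(h, y) \<in> U n (p y n)" "p y n \<le> max (g n) (q n)"
      unfolding MOST_nat_le by (meson le_max_iff_disj order_refl order_trans)
    then show ?thesis
      using monoD[OF mono[of n]] by blast
  qed
  then show "\<exists>g. \<forall>x\<in>topspace (prod_topology H (top_of_set Y)). \<exists>n. x \<in> U n (g n)"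
    by (intro exI[of _ "\<lambda>n. max (g n) (q n)"]) auto
qed

section \<open>A concentrated set whose product with an unbounded space is not Menger\<close>

lemma openin_cantor_real_image:
  "openin (top_of_set (cantor_real ` S)) (cantor_real ` {A \<in> S. P (A \<inter> {..n})})"
  unfolding openin_contains_ball
proof (intro conjI ballI)
  fix y assume "y \<in> cantor_real ` {A \<in> S. P (A \<inter> {..n})}"
  then obtain A where A: "y = cantor_real A" "A \<in> S" "P (A \<inter> {..n})"
    by blast
  have "ball y ((1/3)^n / 2) \<inter> cantor_real ` S \<subseteq> cantor_real ` {A \<in> S. P (A \<inter> {..n})}"
  proof
    fix y' assume y': "y' \<in> ball y ((1/3)^n / 2) \<inter> cantor_real ` S"
    then obtain B where B: "y' = cantor_real B" "B \<in> S"
      by blast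
    then have "A \<inter> {..n} = B \<inter> {..n}"
      using y' A(1) by (intro cantor_real_agree) simp
    then show "y' \<in> cantor_real ` {A \<in> S. P (A \<inter> {..n})}"
      using A(3) B by auto
  qed
  then show "\<exists>e>0. ball y e \<inter> cantor_real ` S \<subseteq> cantor_real ` {A \<in> S. P (A \<inter> {..n})}"
    by (intro exI[of _ "(1/3)^n / 2"]) simp
qed blast

lemma cantor_real_neighbourhood:
  assumes "openin (top_of_set Y) U" "cantor_real A \<in> U"
  obtains p where "\<And>B. B \<inter> {..<p} = A \<inter> {..<p} \<Longrightarrow> cantor_real B \<in> Y \<Longrightarrow> cantor_real B \<in> U"
proof -
  obtain e where e: "e > 0" "ball (cantor_real A) e \<inter> Y \<subseteq> U"
    using assms unfolding openin_contains_ball by blast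
  obtain p where p: "(1/3::real)^p < e * 2 / 3"
    using real_arch_pow_inv[of "e * 2 / 3" "1/3"] e(1) by auto
  show thesis
  proof
    fix B assume B: "B \<inter> {..<p} = A \<inter> {..<p}" "cantor_real B \<in> Y"
    have "dist (cantor_real A) (cantor_real B) \<le> 3/2 * (1/3)^p"
      using B(1) by (intro cantor_real_close) simp
    also have "\<dots> < e"
      using p by simp
    finally show "cantor_real B \<in> U"
      using e(2) B(2) by auto
  qed
qed

text \<open>Up to a finite initial part, a set containing a long interval \<open>{n..p}\<close> is close to a
  cofinite set, and there are only finitely many initial parts.\<close>

lemma open_superset_cofinite:
  assumes U: "openin (top_of_set Y) U" "cantor_real ` {A. finite (- A)} \<subseteq> U"
  obtains b :: "nat \<Rightarrow> nat"
  where "\<And>n A. {n..b n} \<subseteq> A \<Longrightarrow> cantor_real A \<in> Y \<Longrightarrow> cantor_real A \<in> U"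
proof -
  have "\<exists>p. \<forall>A. {n..p} \<subseteq> A \<and> cantor_real A \<in> Y \<longrightarrow> cantor_real A \<in> U" for n
  proof -
    have "\<exists>p. \<forall>B. B \<inter> {..<p} = (F \<union> {n..}) \<inter> {..<p} \<and> cantor_real B \<in> Y \<longrightarrow> cantor_real B \<in> U" for F
    proof -
      have "- (F \<union> {n..}) \<subseteq> {..<n}" by auto
      then have "cantor_real (F \<union> {n..}) \<in> U"
        using U(2) finite_subset[of _ "{..<n}"] by blast
      then show ?thesis
        using cantor_real_neighbourhood[OF U(1)] by metis
    qed
    then obtain p where p: "\<And>F B. B \<inter> {..<p F} = (F \<union> {n..}) \<inter> {..<p F} \<Longrightarrow>
        cantor_real B \<in> Y \<Longrightarrow> cantor_real B \<in> U"
      by metis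
    define M where "M = Max (p ` Pow {..<n})"
    have "cantor_real A \<in> U" if A: "{n..M} \<subseteq> A" "cantor_real A \<in> Y" for A
    proof (rule p[OF _ A(2)])
      have "p (A \<inter> {..<n}) \<le> M"
        unfolding M_def by (intro Max_ge) auto
      then show "A \<inter> {..<p (A \<inter> {..<n})} = (A \<inter> {..<n} \<union> {n..}) \<inter> {..<p (A \<inter> {..<n})}"
        using A(1) by force
    qed
    then show ?thesis
      by blast
  qed
  then show thesis
    using that by metis
qed

section \<open>Long intervals and scales\<close>

text \<open>A sequence \<open>s\<close> in \<open>N\<close> is chosen so sparse that the intervals
  from \<open>s i\<close> to \<open>e (s i)\<close> leave gaps. Their union is \<open>J\<close>, and
  the points \<open>Suc (e (s i))\<close> in the gaps make it coinfinite.\<close>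

lemma long_intervals:
  fixes e :: "nat \<Rightarrow> nat"
  assumes e: "strict_mono e" and N: "infinite N"
  obtains J where "infinite (- J)" "\<And>k. k \<in> J \<Longrightarrow> \<exists>n\<in>N. n \<le> k \<and> k \<le> e n"
    "\<exists>\<^sub>\<infinity>n. {n..e n} \<subseteq> J"
proof -
  have "\<exists>s. \<forall>i. s i \<in> N \<and> Suc (e (s i)) < s (Suc i)"
  proof (rule dependent_nat_choice)
    show "\<exists>x. x \<in> N"
      using N infinite_imp_nonempty by blast
    show "\<exists>y. y \<in> N \<and> Suc (e x) < y" for x
      using N unfolding infinite_nat_iff_unbounded by blast
  qed
  then obtain s where s: "\<And>i. s i \<in> N" "\<And>i. Suc (e (s i)) < s (Suc i)"
    by blast
  have le: "n \<le> e n" for n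
    using e by (rule strict_mono_imp_increasing)
  have mono_s: "strict_mono s"
    by (rule strict_monoI_Suc) (use le s(2) in \<open>meson Suc_lessD le_less_trans\<close>)
  have ge: "i \<le> s i" for i
    using mono_s by (rule strict_mono_imp_increasing)
  define J where "J = (\<Union>i. {s i..e (s i)})"
  have notin: "Suc (e (s i)) \<notin> J" for i
  proof
    assume "Suc (e (s i)) \<in> J"
    then obtain j where j: "s j \<le> Suc (e (s i))" "Suc (e (s i)) \<le> e (s j)"
      by (auto simp: J_def)
    then have "i < j"
      using e mono_s by (metis Suc_le_lessD strict_mono_less)
    then have "s (Suc i) \<le> s j"
      using mono_s by (simp add: strict_mono_less_eq Suc_leI)
    then show False
      using j(1) s(2)[of i] by simp
  qed
  show thesis
  proof
    show "infinite (- J)"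
      unfolding infinite_nat_iff_unbounded_le
    proof
      fix m
      have "m \<le> Suc (e (s m))"
        using ge[of m] le[of "s m"] by simp
      then show "\<exists>n\<ge>m. n \<in> - J"
        using notin[of m] by blast
    qed
    show "\<exists>n\<in>N. n \<le> k \<and> k \<le> e n" if "k \<in> J" for k
      using that s(1) by (auto simp: J_def)
    show "\<exists>\<^sub>\<infinity>n. {n..e n} \<subseteq> J"
      unfolding INFM_nat_le using ge by (auto simp: J_def)
  qed
qed

lemma dominating_family_functions:
  fixes b :: "nat \<Rightarrow> nat"
  assumes "dominating_family D"
  shows "\<exists>d\<in>D. \<forall>\<^sub>\<infinity>n. b n \<le> enumerate d n"
proof -
  obtain a where a: "a \<in> infinite_subsets" "\<And>n. b n \<le> enumerate a n"
    using ex_infinite_subset_dominating[of b] by blast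
  then obtain d where d: "d \<in> D" "a \<le>* d"
    using assms by (auto simp: dominating_family_def)
  have "\<forall>\<^sub>\<infinity>n. b n \<le> enumerate d n"
    using d(2) unfolding le_star_iff by (rule eventually_mono) (use a(2) order_trans in blast)
  then show ?thesis
    using d(1) by blast
qed

text \<open>The sets \<open>J a\<close> in the proof are taken coinfinite in order that there be d many of them.\<close>

lemma unbounded_function_imp_not_Menger_prod:
  fixes f :: "'z \<Rightarrow> nat \<Rightarrow> nat"
  assumes bd: "frak_b =o frak_d"
    and op: "\<And>n m. openin Z {z \<in> topspace Z. f z n \<le> m}"
    and mono: "\<And>z. z \<in> topspace Z \<Longrightarrow> mono (f z)"
    and unb: "\<not> (\<exists>g. \<forall>z\<in>topspace Z. \<forall>\<^sub>\<infinity>n. f z n \<le> g n)"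
  obtains Y :: "real set" where "concentrated frak_d (top_of_set Y)"
    "\<not> Menger_space (prod_topology Z (top_of_set Y))"
proof -
  obtain D where D: "dominating_family D" "frak_d = |D|"
    using frak_d(1) by blast
  \<comment> \<open>A cardinal order is a well-order whose proper initial segments are all smaller
    than the whole. Here they are smaller than d, hence than b, so \<open>D\<close> can index a
    scale.\<close>
  define r where "r = |D|"
  have card_r: "Card_order r" and Field_r: "Field r = D" and wo: "wo_rel r"
    unfolding r_def wo_rel_def
    by (rule card_of_Card_order Field_card_of card_of_Well_order)+
  have db: "r \<le>o frak_b"
    using bd D(2) r_def ordIso_symmetric ordIso_iff_ordLeq by metis
  \<comment> \<open>Domination of all predecessors makes the functions \<open>e\<close> a scale, the
    intervals in \<open>J\<close> give concentration, and \<open>e k < f z k\<close> on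
    \<open>J\<close> defeats the Menger property.\<close>
  define good where "good a e z J \<longleftrightarrow>
      strict_mono e \<and> (\<forall>d. (d, a) \<in> r \<longrightarrow> (\<forall>\<^sub>\<infinity>n. enumerate d n \<le> e n)) \<and>
      z \<in> topspace Z \<and> (\<forall>k\<in>J. e k < f z k) \<and> (\<exists>\<^sub>\<infinity>n. {n..e n} \<subseteq> J) \<and> infinite (- J)"
    for a z J and e :: "nat \<Rightarrow> nat"
  have "\<exists>e z J. good a e z J" if a: "a \<in> D" for a
  proof -
    have "|underS r a| <o frak_b"
      using card_of_underS[OF card_r] a Field_r db ordLess_ordLeq_trans by blast
    then obtain g where g: "\<And>d. d \<in> underS r a \<Longrightarrow> \<forall>\<^sub>\<infinity>n. enumerate d n \<le> g n"
      by (rule bounded_if_card_less_frak_b[of _ enumerate]) blast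
    \<comment> \<open>The function \<open>g\<close> accounts for the proper predecessors of
      \<open>a\<close>, the enumeration for \<open>a\<close> itself, and \<open>majorant\<close> for
      strict monotonicity.\<close>
    define e where "e = majorant (\<lambda>n. max (g n) (enumerate a n))"
    have e: "strict_mono e"
      unfolding e_def by (rule strict_mono_majorant)
    have ge: "max (g n) (enumerate a n) \<le> e n" for n
      unfolding e_def by (rule majorant_ge)
    have dom: "\<forall>\<^sub>\<infinity>n. enumerate d n \<le> e n" if "(d, a) \<in> r" for d
    proof (cases "d = a")
      case True
      then show ?thesis using ge by simp
    next
      case False
      then have "d \<in> underS r a"
        using that by (simp add: underS_def)
      from g[OF this] show ?thesis
        by (rule eventually_mono) (use ge in \<open>meson max.boundedE order_trans\<close>)
    qed
    \<comment> \<open>Testing against \<open>e \<circ> e\<close> instead of \<open>e\<close> gives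
      whole intervals: if \<open>e (e n) < f z n\<close>, then
      \<open>e k \<le> e (e n) < f z n \<le> f z k\<close> for all \<open>k\<close> in
      \<open>{n..e n}\<close>.\<close>
    have "\<not> (\<forall>z\<in>topspace Z. \<forall>\<^sub>\<infinity>n. f z n \<le> e (e n))"
      using spec[OF unb[unfolded not_ex], of "\<lambda>n. e (e n)"] .
    then obtain z where z: "z \<in> topspace Z" "\<not> (\<forall>\<^sub>\<infinity>n. f z n \<le> e (e n))"
      by blast
    have "infinite {n. \<not> f z n \<le> e (e n)}"
      using z(2) unfolding eventually_cofinite .
    then obtain J where J: "infinite (- J)" "\<exists>\<^sub>\<infinity>n. {n..e n} \<subseteq> J"
      "\<And>k. k \<in> J \<Longrightarrow> \<exists>n\<in>{n. \<not> f z n \<le> e (e n)}. n \<le> k \<and> k \<le> e n"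
      by (rule long_intervals[OF e]) blast
    have "e k < f z k" if "k \<in> J" for k
    proof -
      obtain n where n: "e (e n) < f z n" "n \<le> k" "k \<le> e n"
        using J(3)[OF \<open>k \<in> J\<close>] by (metis mem_Collect_eq not_le)
      have "e k \<le> e (e n)"
        using e n(3) by (simp add: strict_mono_less_eq)
      also note n(1)
      also have "f z n \<le> f z k"
        using mono[OF z(1)] n(2) by (rule monoD)
      finally show ?thesis .
    qed
    with e dom z(1) J(1,2) show ?thesis
      unfolding good_def by blast
  qed
  then obtain e z J where good: "\<And>a. a \<in> D \<Longrightarrow> good a (e a) (z a) (J a)"
    by metis
  have e: "\<And>a. a \<in> D \<Longrightarrow> strict_mono (e a)"
    and dom: "\<And>a d. a \<in> D \<Longrightarrow> (d, a) \<in> r \<Longrightarrow> \<forall>\<^sub>\<infinity>n. enumerate d n \<le> e a n"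
    and z: "\<And>a. a \<in> D \<Longrightarrow> z a \<in> topspace Z" "\<And>a k. a \<in> D \<Longrightarrow> k \<in> J a \<Longrightarrow> e a k < f (z a) k"
    and J: "\<And>a. a \<in> D \<Longrightarrow> \<exists>\<^sub>\<infinity>n. {n..e a n} \<subseteq> J a" "\<And>a. a \<in> D \<Longrightarrow> infinite (- J a)"
    using good unfolding good_def by blast+
  \<comment> \<open>The scale property: the indices at which domination of \<open>b\<close> can fail
    are proper predecessors of one \<open>d\<close>, hence fewer than d many.\<close>
  have dominated: "\<exists>d\<in>D. \<forall>a\<in>D. (d, a) \<in> r \<longrightarrow> (\<forall>\<^sub>\<infinity>n. b n \<le> e a n)" for b :: "nat \<Rightarrow> nat"
  proof -
    obtain d where d: "d \<in> D" "\<forall>\<^sub>\<infinity>n. b n \<le> enumerate d n"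
      using dominating_family_functions[OF D(1)] by blast
    have "\<forall>\<^sub>\<infinity>n. b n \<le> e a n" if "a \<in> D" "(d, a) \<in> r" for a
      using d(2) dom[OF that] by eventually_elim (rule order_trans)
    then show ?thesis
      using d(1) by blast
  qed
  have refl_r: "(d, d) \<in> r" if "d \<in> D" for d
    using wo_rel.REFL[OF wo] that Field_r by (auto simp: refl_on_def)
  define S where "S = J ` D \<union> {A. finite (- A)}"
  define Y where "Y = cantor_real ` S"
  show thesis
  proof
    show "concentrated frak_d (top_of_set Y)"
      unfolding concentrated_def D(2) r_def[symmetric]
    proof (intro conjI exI allI impI; (elim conjE)?)
      show "r \<le>o |topspace (top_of_set Y)|"
      proof (rule ccontr)
        assume "\<not> r \<le>o |topspace (top_of_set Y)|"
        then have "|Y| <o r"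
          by (simp add: r_def not_ordLeq_iff_ordLess card_of_Well_order)
        then have "|Y| <o frak_b"
          using db by (rule ordLess_ordLeq_trans)
        \<comment> \<open>The next-gap functions of fewer than b sets have a common bound
          \<open>g\<close>. But some \<open>J d\<close> infinitely often contains
          \<open>{n..e d n}\<close> with \<open>g n \<le> e d n\<close>, so its next gap comes
          later. This argument counts the sets without requiring \<open>J\<close> to be
          injective.\<close>
        then obtain g where g: "\<And>y. y \<in> Y \<Longrightarrow>
            \<forall>\<^sub>\<infinity>n. (LEAST k. n \<le> k \<and> k \<notin> inv cantor_real y) \<le> g n"
          by (rule bounded_if_card_less_frak_b[of _ "\<lambda>y n. LEAST k. n \<le> k \<and> k \<notin> inv cantor_real y"]) blast
        obtain d where d: "d \<in> D" "\<forall>\<^sub>\<infinity>n. g n \<le> e d n"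
          using dominated[of g] refl_r by blast
        have "\<forall>\<^sub>\<infinity>n. (LEAST k. n \<le> k \<and> k \<notin> J d) \<le> g n"
          using g[of "cantor_real (J d)"] d(1) by (simp add: Y_def S_def inv_f_f inj_cantor_real)
        with d(2) have "\<forall>\<^sub>\<infinity>n. (LEAST k. n \<le> k \<and> k \<notin> J d) \<le> e d n"
          by eventually_elim simp
        then have "\<exists>\<^sub>\<infinity>n. {n..e d n} \<subseteq> J d \<and> (LEAST k. n \<le> k \<and> k \<notin> J d) \<le> e d n"
          using J(1)[OF d(1)] by (simp add: INFM_conjI)
        then obtain n where n: "{n..e d n} \<subseteq> J d" "(LEAST k. n \<le> k \<and> k \<notin> J d) \<le> e d n"
          by (auto dest: INFM_EX)
        have "\<exists>k. n \<le> k \<and> k \<notin> J d"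
          using J(2)[OF d(1)] unfolding infinite_nat_iff_unbounded_le by auto
        from LeastI_ex[OF this] show False
          using n by auto
      qed
      show "cantor_real ` {A. finite (- A)} \<subseteq> topspace (top_of_set Y)"
        by (auto simp: Y_def S_def)
      have "{A :: nat set. finite (- A)} = uminus ` {A. finite A}"
        by (auto intro: rev_image_eqI[where x = "- _"])
      then show "countable (cantor_real ` {A. finite (- A)})"
        by (simp add: countable_Collect_finite)
      fix U assume U: "openin (top_of_set Y) U" "cantor_real ` {A. finite (- A)} \<subseteq> U"
      then obtain b where b: "\<And>n A. {n..b n} \<subseteq> A \<Longrightarrow> cantor_real A \<in> Y \<Longrightarrow> cantor_real A \<in> U"
        by (rule open_superset_cofinite) blast
      obtain d where d: "d \<in> D" "\<And>a. a \<in> D \<Longrightarrow> (d, a) \<in> r \<Longrightarrow> \<forall>\<^sub>\<infinity>n. b n \<le> e a n"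
        using dominated[of b] by blast
      \<comment> \<open>Infinitely many intervals \<open>{n..e a n}\<close> lie in
        \<open>J a\<close>, and almost all of them are long enough for \<open>b\<close>.\<close>
      have above: "cantor_real (J a) \<in> U" if a: "a \<in> D" "(d, a) \<in> r" for a
      proof -
        have "\<exists>\<^sub>\<infinity>n. {n..e a n} \<subseteq> J a \<and> b n \<le> e a n"
          using J(1)[OF a(1)] d(2)[OF a] by (rule INFM_conjI)
        then obtain n where "{n..e a n} \<subseteq> J a" "b n \<le> e a n"
          by (auto dest: INFM_EX)
        then have "{n..b n} \<subseteq> J a"
          by auto
        then show ?thesis
          using a(1) by (intro b) (auto simp: Y_def S_def)
      qed
      have "Y - U \<subseteq> (\<lambda>a. cantor_real (J a)) ` underS r d"
      proof
        fix y assume y: "y \<in> Y - U"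
        then obtain a where a: "a \<in> D" "y = cantor_real (J a)"
          using U(2) by (auto simp: Y_def S_def)
        then have "(d, a) \<notin> r"
          using above y by blast
        then have "a \<in> underS r d"
          using wo_rel.TOTALS[OF wo] refl_r[of d] a(1) d(1) unfolding Field_r underS_def by blast
        then show "y \<in> (\<lambda>a. cantor_real (J a)) ` underS r d"
          using a(2) by blast
      qed
      then have "|Y - U| \<le>o |(\<lambda>a. cantor_real (J a)) ` underS r d|"
        by (rule card_of_mono1)
      also have "|(\<lambda>a. cantor_real (J a)) ` underS r d| \<le>o |underS r d|"
        by (rule card_of_image)
      also have "|underS r d| <o r"
        using card_of_underS[OF card_r] d(1) Field_r by blast
      finally show "|topspace (top_of_set Y) - U| <o r"
        by simp
    qed
    show "\<not> Menger_space (prod_topology Z (top_of_set Y))"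
    proof
      assume M: "Menger_space (prod_topology Z (top_of_set Y))"
      define C where "C k = cantor_real ` {A \<in> S. k \<in> A}" for k
      have openC: "openin (top_of_set Y) (C k)" for k
        using openin_cantor_real_image[of S "\<lambda>A. k \<in> A" k] by (simp add: C_def Y_def)
      \<comment> \<open>Every \<open>A \<in> S\<close> is infinite, so some \<open>k \<ge> n\<close>
        lies in \<open>A\<close>, and \<open>m = f w k\<close> puts
        \<open>(w, cantor_real A)\<close> into \<open>U n m\<close>.\<close>
      define U where "U n m = (\<Union>k\<in>{n..}. {z \<in> topspace Z. f z k \<le> m} \<times> C k)" for n m
      have "openin (prod_topology Z (top_of_set Y)) (U n m)" for n m
        unfolding U_def using op openC by (intro openin_Union) (auto simp: openin_prod_Times_iff)
      moreover have "mono (U n)" for n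
        unfolding U_def mono_def by fastforce
      moreover have "\<exists>m. x \<in> U n m" if "x \<in> topspace (prod_topology Z (top_of_set Y))" for n x
      proof -
        obtain w A where x: "x = (w, cantor_real A)" "w \<in> topspace Z" "A \<in> S"
          using \<open>x \<in> _\<close> by (auto simp: Y_def)
        have "infinite A"
        proof (cases "finite (- A)")
          case True
          then show ?thesis
            using finite_Un[of A "- A"] by auto
        next
          case False
          then obtain a where a: "a \<in> D" "A = J a"
            using x(3) by (auto simp: S_def)
          have "\<exists>\<^sub>\<infinity>n. n \<in> J a"
          proof -
            have le: "n \<le> e a n" for n
              using e[OF a(1)] by (rule strict_mono_imp_increasing)
            show ?thesis
              using J(1)[OF a(1)] by (rule INFM_mono) (use le in auto)
          qed
          then show ?thesis
            by (simp add: a(2) frequently_cofinite)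
        qed
        then obtain k where "k \<ge> n" "k \<in> A"
          unfolding infinite_nat_iff_unbounded_le by blast
        then show ?thesis
          using x by (intro exI[of _ "f w k"]) (auto simp: U_def C_def)
      qed
      ultimately obtain g where g: "\<And>x. x \<in> topspace (prod_topology Z (top_of_set Y)) \<Longrightarrow>
          \<exists>\<^sub>\<infinity>n. x \<in> U n (g n)"
        using Menger_space_seqD[OF M, of U] by blast
      \<comment> \<open>The pair of \<open>z d\<close> and \<open>J d\<close> escapes the selection:
        a hit at a late \<open>n\<close> would give some \<open>k \<ge> n\<close> in
        \<open>J d\<close> with
        \<open>f (z d) k \<le> g n \<le> e d n \<le> e d k < f (z d) k\<close>.\<close>
      obtain d where d: "d \<in> D" "\<forall>\<^sub>\<infinity>n. g n \<le> e d n"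
        using dominated[of g] refl_r by blast
      have "\<exists>\<^sub>\<infinity>n. (z d, cantor_real (J d)) \<in> U n (g n)"
        using z(1)[OF d(1)] d(1) by (intro g) (auto simp: Y_def S_def)
      then have "\<exists>\<^sub>\<infinity>n. (z d, cantor_real (J d)) \<in> U n (g n) \<and> g n \<le> e d n"
        using d(2) by (rule INFM_conjI)
      then obtain n where n: "(z d, cantor_real (J d)) \<in> U n (g n)" "g n \<le> e d n"
        by (auto dest: INFM_EX)
      then obtain k A where k: "k \<ge> n" "f (z d) k \<le> g n" "k \<in> A" "cantor_real (J d) = cantor_real A"
        by (auto simp: U_def C_def)
      then have "k \<in> J d"
        using inj_cantor_real by (auto dest: injD)
      then have "e d k < f (z d) k"
        using z(2) d(1) by blast
      moreover have "e d n \<le> e d k"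
        using e[OF d(1)] k(1) by (simp add: strict_mono_less_eq)
      ultimately show False
        using k(2) n(2) by simp
    qed
  qed
qed

section \<open>Enumerations and the topology of the Cantor space\<close>

lemma topspace_cantor_topology: "topspace cantor_topology = UNIV"
  by (simp add: cantor_topology_def topspace_pullback_topology)

text \<open>The condition depends on finitely many coordinates, so the set is a union of finite
  intersections of subbasic sets.\<close>

lemma openin_cantor_topology_initial_segment:
  "openin cantor_topology {A. P (A \<inter> {..m})}"
proof -
  have "openin cantor_topology {A. k \<in> A \<longleftrightarrow> b}" for k b
  proof -
    have "continuous_map cantor_topology (discrete_topology UNIV) ((\<lambda>f. f k) \<circ> (\<lambda>A n. n \<in> A))"
      unfolding cantor_topology_def
      by (intro continuous_map_pullback continuous_map_product_projection) simp
    then have "openin cantor_topology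
        {A \<in> topspace cantor_topology. ((\<lambda>f. f k) \<circ> (\<lambda>A n. n \<in> A)) A \<in> {b}}"
      by (rule openin_continuous_map_preimage) simp
    then show ?thesis
      by (simp add: topspace_cantor_topology)
  qed
  then have "openin cantor_topology (\<Inter>k\<in>{..m}. {A. k \<in> A \<longleftrightarrow> k \<in> F})" for F
    by (intro openin_Inter) auto
  then have "openin cantor_topology (\<Union>F\<in>{F. P (F \<inter> {..m})}. \<Inter>k\<in>{..m}. {A. k \<in> A \<longleftrightarrow> k \<in> F})"
    by (intro openin_Union) auto
  also have "(\<Union>F\<in>{F. P (F \<inter> {..m})}. \<Inter>k\<in>{..m}. {A. k \<in> A \<longleftrightarrow> k \<in> F}) = {A. P (A \<inter> {..m})}"
    (is "?L = ?R")
  proof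
    show "?L \<subseteq> ?R"
    proof
      fix A assume "A \<in> ?L"
      then obtain F where F: "P (F \<inter> {..m})" "\<And>k. k \<le> m \<Longrightarrow> k \<in> A \<longleftrightarrow> k \<in> F"
        by auto
      then have "A \<inter> {..m} = F \<inter> {..m}"
        by auto
      then show "A \<in> ?R"
        using F(1) by simp
    qed
  qed auto
  finally show ?thesis .
qed

text \<open>As long as the enumeration of \<open>A\<close> stays within \<open>{..m}\<close>, each
  search for the next element sees only the common part of the two sets. Hence
  \<open>enumerate x n \<le> m\<close> is decided by \<open>x \<inter> {..m}\<close>.\<close>

lemma enumerate_cong_initial_segment:
  fixes A B :: "nat set"
  assumes inf: "infinite A" "infinite B" and eq: "A \<inter> {..m} = B \<inter> {..m}"
  shows "enumerate A n \<le> m \<Longrightarrow> enumerate B n = enumerate A n"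
proof (induction n)
  case 0
  have "(LEAST k. k \<in> B) = enumerate A 0"
  proof (rule Least_equality)
    show "enumerate A 0 \<in> B"
      using 0 eq enumerate_in_set[OF inf(1), of 0] by blast
    fix k assume k: "k \<in> B"
    show "enumerate A 0 \<le> k"
    proof (rule ccontr)
      assume less: "\<not> enumerate A 0 \<le> k"
      then have "k \<in> A"
        using 0 k eq by fastforce
      then show False
        using less by (simp add: enumerate_0 Least_le)
    qed
  qed
  then show ?case by (simp add: enumerate_0)
next
  case (Suc n)
  let ?v = "enumerate A n" and ?w = "enumerate A (Suc n)"
  have vw: "?v < ?w"
    using inf(1) by (rule enumerate_step)
  then have v: "enumerate B n = ?v"
    using Suc by simp
  have "(LEAST k. k \<in> B \<and> ?v < k) = ?w"
  proof (rule Least_equality)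
    show "?w \<in> B \<and> ?v < ?w"
      using Suc(2) eq enumerate_in_set[OF inf(1), of "Suc n"] vw by blast
    fix k assume k: "k \<in> B \<and> ?v < k"
    show "?w \<le> k"
    proof (rule ccontr)
      assume less: "\<not> ?w \<le> k"
      then have "k \<in> A"
        using Suc(2) k eq by fastforce
      then show False
        using less k by (simp add: enumerate_Suc''[OF inf(1)] Least_le)
    qed
  qed
  then show ?case
    by (simp add: enumerate_Suc''[OF inf(2)] v)
qed

lemma openin_enumerate_le:
  assumes "X \<subseteq> infinite_subsets"
  shows "openin (subtopology cantor_topology X) {x \<in> X. enumerate x n \<le> m}"
proof -
  have "enumerate A n \<le> m" if "A \<in> X" "x \<in> X" "x \<inter> {..m} = A \<inter> {..m}" "enumerate x n \<le> m" for A x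
    using enumerate_cong_initial_segment[of x A m n] that assms
    unfolding infinite_subsets_def by (metis mem_Collect_eq subsetD)
  then have "{x \<in> X. enumerate x n \<le> m} =
      {A. \<exists>x\<in>X. x \<inter> {..m} = A \<inter> {..m} \<and> enumerate x n \<le> m} \<inter> X"
    by blast
  moreover have "openin cantor_topology {A. \<exists>x\<in>X. x \<inter> {..m} = A \<inter> {..m} \<and> enumerate x n \<le> m}"
    by (rule openin_cantor_topology_initial_segment[where
          P = "\<lambda>F. \<exists>x\<in>X. x \<inter> {..m} = F \<and> enumerate x n \<le> m"])
  ultimately show ?thesis
    by (simp only: openin_subtopology_Int)
qed

lemma unbounded_family_imp_enumerate_unbounded:
  assumes "unbounded_family X"
  shows "\<not> (\<exists>g. \<forall>x\<in>X. \<forall>\<^sub>\<infinity>n. enumerate x n \<le> g n)"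
proof
  assume "\<exists>g. \<forall>x\<in>X. \<forall>\<^sub>\<infinity>n. enumerate x n \<le> g n"
  then obtain g where g: "\<And>x. x \<in> X \<Longrightarrow> \<forall>\<^sub>\<infinity>n. enumerate x n \<le> g n"
    by blast
  obtain b where b: "b \<in> infinite_subsets" "\<And>n. g n \<le> enumerate b n"
    using ex_infinite_subset_dominating[of g] by blast
  have "x \<le>* b" if "x \<in> X" for x
    unfolding le_star_iff using g[OF that]
    by (rule eventually_mono) (use b(2) order_trans in blast)
  then show False
    using assms b(1) by (auto simp: unbounded_family_def)
qed

section \<open>Copies of topologies on other types\<close>

text \<open>The image of \<open>q\<close> receives the finest topology that makes \<open>q\<close>
  continuous. This serves both to identify points and, for injective maps, to move a space to
  another type.\<close>

lemma ex_quotient_topology: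
  obtains Q where "quotient_map X Q q"
proof -
  define Q where "Q = topology (\<lambda>V. V \<subseteq> q ` topspace X \<and> openin X {x \<in> topspace X. q x \<in> V})"
  have "istopology (\<lambda>V. V \<subseteq> q ` topspace X \<and> openin X {x \<in> topspace X. q x \<in> V})"
    unfolding istopology_def
  proof (intro conjI allI impI)
    fix S T assume *: "S \<subseteq> q ` topspace X \<and> openin X {x \<in> topspace X. q x \<in> S}"
      "T \<subseteq> q ` topspace X \<and> openin X {x \<in> topspace X. q x \<in> T}"
    have "{x \<in> topspace X. q x \<in> S \<inter> T} =
        {x \<in> topspace X. q x \<in> S} \<inter> {x \<in> topspace X. q x \<in> T}"
      by auto
    with * show "openin X {x \<in> topspace X. q x \<in> S \<inter> T}" "S \<inter> T \<subseteq> q ` topspace X"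
      by auto
  next
    fix K assume *: "\<forall>S\<in>K. S \<subseteq> q ` topspace X \<and> openin X {x \<in> topspace X. q x \<in> S}"
    have "{x \<in> topspace X. q x \<in> \<Union>K} = (\<Union>S\<in>K. {x \<in> topspace X. q x \<in> S})"
      by auto
    moreover have "openin X (\<Union>S\<in>K. {x \<in> topspace X. q x \<in> S})"
      using * by (intro openin_Union) auto
    ultimately show "openin X {x \<in> topspace X. q x \<in> \<Union>K}"
      by simp
    show "\<Union>K \<subseteq> q ` topspace X"
      using * by blast
  qed
  then have op: "openin Q V \<longleftrightarrow> V \<subseteq> q ` topspace X \<and> openin X {x \<in> topspace X. q x \<in> V}" for V
    by (simp add: Q_def topology_inverse')
  have "openin Q (q ` topspace X)"
  proof -
    have "{x \<in> topspace X. q x \<in> q ` topspace X} = topspace X"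
      by auto
    then show ?thesis
      by (simp add: op)
  qed
  then have "topspace Q = q ` topspace X"
    using op by (metis openin_subset openin_topspace subset_antisym)
  then show thesis
    by (intro that[of Q]) (simp add: quotient_map_def op)
qed

lemma ex_homeomorphic_copy:
  assumes "inj_on j (topspace X)"
  obtains Q where "homeomorphic_map X Q j"
proof -
  obtain Q where "quotient_map X Q j"
    by (rule ex_quotient_topology)
  with assms show thesis
    by (intro that[of Q]) (simp add: homeomorphic_map_def)
qed

lemma second_countable_top_of_set:
  "second_countable (top_of_set (S :: 'a::second_countable_topology set))"
proof -
  obtain B :: "'a set set" where B: "countable B" "topological_basis B"
    using ex_countable_basis by blast
  have "second_countable (euclidean :: 'a topology)"
    unfolding second_countable_def
  proof (intro exI[of _ B] conjI allI impI ballI; (elim conjE)?)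
    fix V assume "V \<in> B"
    then show "openin euclidean V"
      using topological_basis_open[OF B(2)] by simp
  next
    fix U :: "'a set" and x assume "openin euclidean U" "x \<in> U"
    then show "\<exists>V\<in>B. x \<in> V \<and> V \<subseteq> U"
      using topological_basisE[OF B(2), of U x] by (metis open_openin)
  qed (rule B(1))
  then show ?thesis
    by (rule second_countable_subtopology)
qed

text \<open>\<open>cantor_real\<close> embeds the sets of naturals into the reals, and the plane has
  the cardinality of the line.\<close>

lemma ex_inj_nat_set_times_real:
  assumes "|UNIV :: real set| \<le>o |UNIV :: 'b set|"
  obtains j :: "nat set \<times> real \<Rightarrow> 'b" where "inj j"
proof -
  have "|UNIV :: (real \<times> real) set| \<le>o |UNIV :: real set|"
    using Card_order_Times_same_infinite[OF card_of_Card_order, of "UNIV :: real set"]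
    by (simp add: Field_card_of infinite_UNIV_char_0)
  then have "\<exists>u :: real \<times> real \<Rightarrow> real. inj u \<and> range u \<subseteq> UNIV"
    by (rule card_of_ordLeq[THEN iffD2])
  then obtain u :: "real \<times> real \<Rightarrow> real" where u: "inj u"
    by blast
  have "\<exists>v :: real \<Rightarrow> 'b. inj v \<and> range v \<subseteq> UNIV"
    using assms by (rule card_of_ordLeq[THEN iffD2])
  then obtain v :: "real \<Rightarrow> 'b" where v: "inj v"
    by blast
  have "inj (\<lambda>(A, t). v (u (cantor_real A, t)))"
    unfolding inj_def split_paired_All
    by (simp add: inj_eq[OF u] inj_eq[OF v] inj_eq[OF inj_cantor_real])
  then show thesis ..
qed

section \<open>Productively Menger sets of reals\<close>

lemma not_Menger_prod_of_unbounded_family: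
  assumes bd: "frak_b =o frak_d" and X: "unbounded_family X"
  shows "\<exists>Y :: real set. concentrated frak_d (top_of_set Y) \<and>
    \<not> Menger_space (prod_topology (subtopology cantor_topology X) (top_of_set Y))"
proof -
  let ?Z = "subtopology cantor_topology X"
  have top: "topspace ?Z = X"
    by (simp add: topspace_cantor_topology)
  have sub: "X \<subseteq> infinite_subsets"
    using X by (simp add: unbounded_family_def)
  have "openin ?Z {x \<in> topspace ?Z. enumerate x n \<le> m}" for n m
    unfolding top using sub by (rule openin_enumerate_le)
  moreover have "mono (enumerate x)" if "x \<in> topspace ?Z" for x
    using that sub unfolding top infinite_subsets_def
    by (intro strict_mono_mono strict_mono_enumerate) blast
  moreover have "\<not> (\<exists>g. \<forall>x\<in>topspace ?Z. \<forall>\<^sub>\<infinity>n. enumerate x n \<le> g n)"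
    unfolding top using X by (rule unbounded_family_imp_enumerate_unbounded)
  ultimately obtain Y :: "real set" where "concentrated frak_d (top_of_set Y)"
    "\<not> Menger_space (prod_topology ?Z (top_of_set Y))"
    by (rule unbounded_function_imp_not_Menger_prod[OF bd]) blast
  then show ?thesis
    by blast
qed

text \<open>The type \<open>'b\<close> of the test spaces may be any type of size at least the continuum, since the
  space needed here has its points in \<open>nat set \<times> real\<close>.\<close>

lemma productively_Menger_on_nat_set_times_real:
  fixes X :: "'x topology" and P :: "(nat set \<times> real) topology"
  assumes card: "|UNIV :: real set| \<le>o |UNIV :: 'b set|"
    and X: "\<And>Y :: 'b topology. hereditarily Lindelof_space Y \<Longrightarrow> Menger_space Y \<Longrightarrow>
      Menger_space (prod_topology X Y)"
    and P: "hereditarily Lindelof_space P" "Menger_space P"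
  shows "Menger_space (prod_topology X P)"
proof -
  obtain j :: "nat set \<times> real \<Rightarrow> 'b" where "inj j"
    using ex_inj_nat_set_times_real[OF card] .
  then have "inj_on j (topspace P)"
    by (rule inj_on_subset) simp
  then obtain Q where "homeomorphic_map P Q j"
    by (rule ex_homeomorphic_copy)
  then obtain k where jk: "homeomorphic_maps P Q j k"
    by (auto simp: homeomorphic_map_maps)
  then have cont: "continuous_map P Q j" "continuous_map Q P k"
    and im: "j ` topspace P = topspace Q" "k ` topspace Q = topspace P"
    using homeomorphic_imp_surjective_map homeomorphic_maps_map by (metis homeomorphic_maps_def)+
  have "Menger_space (prod_topology X Q)"
    using P cont(1) im(1)
    by (intro X hereditarily_Lindelof_continuous_map_image[of P Q j]
        Menger_space_continuous_map_image[of P Q j])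
  then show ?thesis
  proof (rule Menger_space_continuous_map_image)
    show "continuous_map (prod_topology X Q) (prod_topology X P) (\<lambda>z. (fst z, k (snd z)))"
      using continuous_map_compose[OF continuous_map_snd cont(2), of X]
      by (intro continuous_map_pairedI continuous_map_fst) (simp add: o_def)
    show "(\<lambda>z. (fst z, k (snd z))) ` topspace (prod_topology X Q) = topspace (prod_topology X P)"
      unfolding topspace_prod_topology im(2)[symmetric] by force
  qed
qed

text \<open>Nonemptiness of the product makes the countable family of rectangles nonempty, so that
  \<open>from_nat_into\<close> lists it as a sequence.\<close>

lemma rectangle_sequence_refinement:
  assumes X: "second_countable X" and Y: "hereditarily Lindelof_space Y"
    and \<U>: "open_cover (prod_topology X Y) \<U>" and ne: "topspace (prod_topology X Y) \<noteq> {}"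
  obtains A B where "\<And>m::nat. openin X (A m)" "\<And>m. openin Y (B m)"
    "\<And>m. \<exists>U\<in>\<U>. A m \<times> B m \<subseteq> U"
    "\<And>z. z \<in> topspace (prod_topology X Y) \<Longrightarrow> \<exists>m. z \<in> A m \<times> B m"
proof -
  have op: "openin (prod_topology X Y) U" if "U \<in> \<U>" for U
    using \<U> that by (simp add: open_cover_def)
  have un: "\<Union>\<U> = topspace (prod_topology X Y)"
    using \<U> by (simp add: open_cover_def)
  obtain \<R> where \<R>: "countable \<R>"
    "\<And>A B. (A, B) \<in> \<R> \<Longrightarrow> openin X A \<and> openin Y B \<and> (\<exists>U\<in>\<U>. A \<times> B \<subseteq> U)"
    "(\<Union>(A, B)\<in>\<R>. A \<times> B) = \<Union>\<U>"
    using countable_rectangle_refinement[OF X Y op] by blast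
  have "\<R> \<noteq> {}"
    using \<R>(3) ne un by (metis SUP_empty)
  then have range: "range (from_nat_into \<R>) = \<R>"
    using \<R>(1) by (rule range_from_nat_into)
  define A where "A m = fst (from_nat_into \<R> m)" for m
  define B where "B m = snd (from_nat_into \<R> m)" for m
  have AB: "(A m, B m) \<in> \<R>" for m
    using range by (auto simp: A_def B_def)
  show thesis
  proof (rule that[of A B])
    show "openin X (A m)" "openin Y (B m)" "\<exists>U\<in>\<U>. A m \<times> B m \<subseteq> U" for m
      using \<R>(2)[OF AB[of m]] by blast+
    show "\<exists>m. z \<in> A m \<times> B m" if "z \<in> topspace (prod_topology X Y)" for z
    proof -
      have "z \<in> (\<Union>(A, B)\<in>range (from_nat_into \<R>). A \<times> B)"
        using that unfolding range \<R>(3) un .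
      then show ?thesis
        by (auto simp: case_prod_beta A_def B_def)
    qed
  qed
qed

text \<open>The quotient \<open>H\<close> remembers of a point of \<open>Y\<close> only which of countably many open sets contain it.
  It replaces \<open>Y\<close>, whose cardinality need not be bounded by the continuum.\<close>

lemma productively_Menger_imp_Hurewicz_prod:
  fixes X :: "real set" and Y :: "'a topology"
  assumes bd: "frak_b =o frak_d"
    and card: "|UNIV :: real set| \<le>o |UNIV :: 'b set|"
    and X: "\<And>Y :: 'b topology. hereditarily Lindelof_space Y \<Longrightarrow> Menger_space Y \<Longrightarrow>
      Menger_space (prod_topology (top_of_set X) Y)"
    and Y: "hereditarily Lindelof_space Y" "Hurewicz_space Y"
  shows "Hurewicz_space (prod_topology (top_of_set X) Y)"
proof (rule Hurewicz_spaceI_refinement)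
  let ?X = "top_of_set X"
  fix \<U> :: "nat \<Rightarrow> (real \<times> 'a) set set"
  assume \<U>: "\<And>n. open_cover (prod_topology ?X Y) (\<U> n)" and ne: "topspace (prod_topology ?X Y) \<noteq> {}"
  define rects where "rects n A B \<longleftrightarrow> (\<forall>m. openin ?X (A m)) \<and> (\<forall>m. openin Y (B m)) \<and>
      (\<forall>m. \<exists>U\<in>\<U> n. A m \<times> B m \<subseteq> U) \<and>
      (\<forall>z\<in>topspace (prod_topology ?X Y). \<exists>m. z \<in> A m \<times> B m)"
    for n and A :: "nat \<Rightarrow> real set" and B
  have "\<exists>A B. rects n A B" for n
    using rectangle_sequence_refinement[OF second_countable_top_of_set Y(1) \<U> ne, of n]
    unfolding rects_def by metis
  then obtain A B where "\<And>n. rects n (A n) (B n)"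
    by metis
  then have R: "\<And>n m. openin ?X (A n m)" "\<And>n m. openin Y (B n m)"
    "\<And>n m. \<exists>U\<in>\<U> n. A n m \<times> B n m \<subseteq> U"
    "\<And>n z. z \<in> topspace (prod_topology ?X Y) \<Longrightarrow> \<exists>m. z \<in> A n m \<times> B n m"
    unfolding rects_def by blast+
  define q where "q y = {prod_encode (n, m) |n m. y \<in> B n m}" for y
  have q: "prod_encode (n, m) \<in> q y \<longleftrightarrow> y \<in> B n m" for n m y
    by (auto simp: q_def)
  obtain H where "quotient_map Y H q"
    by (rule ex_quotient_topology)
  then have contq: "continuous_map Y H q" and im: "q ` topspace Y = topspace H"
    and openH: "\<And>V. V \<subseteq> topspace H \<Longrightarrow> openin Y {y \<in> topspace Y. q y \<in> V} \<Longrightarrow> openin H V"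
    using quotient_imp_continuous_map by (auto simp: quotient_map_def)
  have qH: "q y \<in> topspace H" if "y \<in> topspace Y" for y
    using that im by blast
  have H: "hereditarily Lindelof_space H" "Hurewicz_space H"
    using Y contq im hereditarily_Lindelof_continuous_map_image Hurewicz_space_continuous_map_image
    by metis+
  \<comment> \<open>Membership of \<open>y\<close> in \<open>B n m\<close> can be read off
    \<open>q y\<close>, so the preimage of \<open>B' n m\<close> is exactly \<open>B n m\<close>,
    and \<open>B' n m\<close> is open in the quotient.\<close>
  define B' where "B' n m = {a \<in> topspace H. prod_encode (n, m) \<in> a}" for n m
  have openB': "openin H (B' n m)" for n m
  proof (rule openH)
    have "{y \<in> topspace Y. q y \<in> B' n m} = B n m"
      using qH openin_subset[OF R(2), of n m] by (auto simp: B'_def q)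
    then show "openin Y {y \<in> topspace Y. q y \<in> B' n m}"
      using R(2) by simp
  qed (auto simp: B'_def)
  define Z where "Z = prod_topology ?X H"
  have coverZ: "\<exists>m. z \<in> A n m \<times> B' n m" if z: "z \<in> topspace Z" for z n
  proof -
    obtain x a where xa: "z = (x, a)" "x \<in> X" "a \<in> q ` topspace Y"
      unfolding im using z by (auto simp: Z_def)
    then obtain y where xy: "z = (x, q y)" "x \<in> X" "y \<in> topspace Y"
      by blast
    then obtain m where "(x, y) \<in> A n m \<times> B n m"
      using R(4)[of "(x, y)" n] by auto
    then show ?thesis
      using xy qH by (auto simp: B'_def q)
  qed
  \<comment> \<open>Treating all \<open>i \<le> n\<close> at once makes \<open>f z\<close>
    nondecreasing, and \<open>f z n \<le> k\<close> is an open condition on \<open>z\<close>. An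
    eventual bound on all \<open>f z\<close> is a Hurewicz selection.\<close>
  define f where "f z n = (LEAST k. \<forall>i\<le>n. \<exists>m\<le>k. z \<in> A i m \<times> B' i m)" for z n
  have ex: "\<exists>k. \<forall>i\<le>n. \<exists>m\<le>k. z \<in> A i m \<times> B' i m" if z: "z \<in> topspace Z" for z n
  proof -
    obtain p where "\<And>i. z \<in> A i (p i) \<times> B' i (p i)"
      using coverZ[OF z] by metis
    then show ?thesis
      by (intro exI[of _ "Max (p ` {..n})"]) (auto intro!: exI[of _ "p _"])
  qed
  have f_le: "f z n \<le> k \<longleftrightarrow> (\<forall>i\<le>n. \<exists>m\<le>k. z \<in> A i m \<times> B' i m)" if z: "z \<in> topspace Z" for z n k
  proof
    assume "f z n \<le> k"
    moreover have "\<forall>i\<le>n. \<exists>m\<le>f z n. z \<in> A i m \<times> B' i m"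
      unfolding f_def using ex[OF z] by (rule LeastI_ex)
    ultimately show "\<forall>i\<le>n. \<exists>m\<le>k. z \<in> A i m \<times> B' i m"
      using order_trans by blast
  next
    assume "\<forall>i\<le>n. \<exists>m\<le>k. z \<in> A i m \<times> B' i m"
    then show "f z n \<le> k"
      unfolding f_def by (rule Least_le)
  qed
  have "\<exists>g. \<forall>z\<in>topspace Z. \<forall>\<^sub>\<infinity>n. f z n \<le> g n"
  proof (rule ccontr)
    assume unb: "\<not> ?thesis"
    have open_f: "openin Z {z \<in> topspace Z. f z n \<le> k}" for n k
    proof -
      have "openin Z (A i m \<times> B' i m)" for i m
        using R(1) openB' by (simp add: Z_def openin_prod_Times_iff)
      then have "openin Z (\<Inter>i\<le>n. \<Union>m\<le>k. A i m \<times> B' i m)"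
        by (intro openin_Inter) auto
      moreover have "{z \<in> topspace Z. f z n \<le> k} = topspace Z \<inter> (\<Inter>i\<le>n. \<Union>m\<le>k. A i m \<times> B' i m)"
        using f_le by (simp add: set_eq_iff Bex_def atMost_iff cong: conj_cong) blast
      ultimately show ?thesis
        by (simp only: openin_Int openin_topspace)
    qed
    have mono_f: "mono (f z)" if "z \<in> topspace Z" for z
    proof (rule monoI)
      fix n n' :: nat assume "n \<le> n'"
      then show "f z n \<le> f z n'"
        using f_le[OF that, of n "f z n'"] f_le[OF that, of n' "f z n'"] order_trans by blast
    qed
    obtain C :: "real set" where C: "concentrated frak_d (top_of_set C)"
      "\<not> Menger_space (prod_topology Z (top_of_set C))"
      using unbounded_function_imp_not_Menger_prod[OF bd open_f mono_f unb] by blast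
    let ?C = "top_of_set C"
    \<comment> \<open>The product lemma expects the second countable factor on the left, so the
      factors are swapped afterwards.\<close>
    have "hereditarily Lindelof_space (prod_topology ?C H)"
      using second_countable_top_of_set H(1) by (rule hereditarily_Lindelof_prod_topology)
    then have HC: "hereditarily Lindelof_space (prod_topology H ?C)"
    proof (rule hereditarily_Lindelof_continuous_map_image)
      show "continuous_map (prod_topology ?C H) (prod_topology H ?C) (\<lambda>z. (snd z, fst z))"
        by (intro continuous_map_pairedI continuous_map_fst continuous_map_snd)
      show "(\<lambda>z. (snd z, fst z)) ` topspace (prod_topology ?C H) = topspace (prod_topology H ?C)"
        by force
    qed
    have "frak_d \<le>o frak_b"
      using bd ordIso_symmetric ordIso_iff_ordLeq by metis
    then have "Menger_space (prod_topology H ?C)"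
      using Hurewicz_imp_Menger_prod_concentrated[OF H(2) hereditarily_inc[OF HC] C(1)] by blast
    then have "Menger_space (prod_topology ?X (prod_topology H ?C))"
      using productively_Menger_on_nat_set_times_real[OF card X HC] by blast
    \<comment> \<open>Reassociating the triple product contradicts the choice of
      \<open>C\<close>.\<close>
    then have "Menger_space (prod_topology Z ?C)"
    proof (rule Menger_space_continuous_map_image)
      let ?h = "\<lambda>z. ((fst z, fst (snd z)), snd (snd z))"
      show "continuous_map (prod_topology ?X (prod_topology H ?C)) (prod_topology Z ?C) ?h"
        unfolding Z_def
        using continuous_map_compose[OF continuous_map_snd[of ?X] continuous_map_fst[of H ?C]]
          continuous_map_compose[OF continuous_map_snd[of ?X] continuous_map_snd[of H ?C]]
        by (intro continuous_map_pairedI continuous_map_fst) (simp_all add: o_def)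
      show "?h ` topspace (prod_topology ?X (prod_topology H ?C)) = topspace (prod_topology Z ?C)"
        unfolding Z_def by force
    qed
    then show False
      using C(2) by blast
  qed
  then obtain g where g: "\<And>z. z \<in> topspace Z \<Longrightarrow> \<forall>\<^sub>\<infinity>n. f z n \<le> g n"
    by blast
  \<comment> \<open>Membership in the rectangles depends on \<open>y\<close> only through
    \<open>q y\<close>, so the bound on \<open>Z\<close> transfers back to the original
    product.\<close>
  have "\<forall>\<^sub>\<infinity>n. \<exists>m\<le>g n. z \<in> A n m \<times> B n m" if z: "z \<in> topspace (prod_topology ?X Y)" for z
  proof -
    obtain x y where xy: "z = (x, y)" "(x, q y) \<in> topspace Z"
      using z qH by (auto simp: Z_def)
    from g[OF xy(2)] show ?thesis
    proof (rule eventually_mono)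
      fix n assume "f (x, q y) n \<le> g n"
      then obtain m where "m \<le> g n" "(x, q y) \<in> A n m \<times> B' n m"
        using f_le[OF xy(2)] by blast
      then show "\<exists>m\<le>g n. z \<in> A n m \<times> B n m"
        using xy(1) by (auto simp: B'_def q)
    qed
  qed
  then show "\<exists>V (g :: nat \<Rightarrow> nat). (\<forall>n m. \<exists>U\<in>\<U> n. V n m \<subseteq> U) \<and>
      (\<forall>z\<in>topspace (prod_topology ?X Y). \<forall>\<^sub>\<infinity>n. \<exists>m\<le>g n. z \<in> V n m)"
    using R(3) by (intro exI[of _ "\<lambda>n m. A n m \<times> B n m"] exI[of _ g]) simp
qed

text \<open>A quantifier over all spaces becomes one over topologies on a type: \<open>'b\<close>
  carries the test spaces for Menger products, and \<open>'a\<close>, of any size, carries the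
  spaces in the Hurewicz conclusion.\<close>

theorem theorem4p8:
  assumes "frak_b =o frak_d"
  shows
    "(\<forall>X. unbounded_family X \<longrightarrow>
        (\<exists>Y :: real set. concentrated frak_d (top_of_set Y) \<and>
           \<not> Menger_space (prod_topology (subtopology cantor_topology X) (top_of_set Y))))
     \<and>
     ( |UNIV :: real set| \<le>o |UNIV :: 'b set| \<longrightarrow>
        (\<forall>X :: real set.
          (\<forall>Y :: 'b topology. hereditarily Lindelof_space Y \<and> Menger_space Y \<longrightarrow>
             Menger_space (prod_topology (top_of_set X) Y)) \<longrightarrow>
          (\<forall>Y :: 'a topology. hereditarily Lindelof_space Y \<and> Hurewicz_space Y \<longrightarrow>
             Hurewicz_space (prod_topology (top_of_set X) Y))))"
proof (intro conjI allI impI; (elim conjE)?)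
  show "\<exists>Y :: real set. concentrated frak_d (top_of_set Y) \<and>
      \<not> Menger_space (prod_topology (subtopology cantor_topology X) (top_of_set Y))"
    if "unbounded_family X" for X
    using assms that by (rule not_Menger_prod_of_unbounded_family)
next
  fix X :: "real set" and Y :: "'a topology"
  assume card: "|UNIV :: real set| \<le>o |UNIV :: 'b set|"
    and X: "\<forall>Y :: 'b topology. hereditarily Lindelof_space Y \<and> Menger_space Y \<longrightarrow>
      Menger_space (prod_topology (top_of_set X) Y)"
    and Y: "hereditarily Lindelof_space Y" "Hurewicz_space Y"
  show "Hurewicz_space (prod_topology (top_of_set X) Y)"
    using assms card X[rule_format, OF conjI] Y by (rule productively_Menger_imp_Hurewicz_prod)
qed

end
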